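(* Let $A\in\mathbb{R}_+^{n\times n}$ be an irreducible definite visualized matrix, let $r\ge T(A)$, and let $\tilde A^{(r)}$ be the reduced power matrix with blocks $\tilde A^{(r)}_{\mu\nu}$ (defined in the context). Let $\mathcal{C}_\mu,\mathcal{C}_\nu$ be two (possibly equal) components of $\mathcal{C}(A)$, and let $d=\gcd(\gamma_\mu,\gamma_\nu)$. (1) $\tilde A^{(r)}_{\mu\nu}$ is a rectangular circulant (which is a circulant if $\mu=\nu$). (2) For any critical $\mu$ and $\nu$, there is a permutation matrix $P$ such that $(P^T\tilde AP)^{(r)}_{\mu\nu}$, i.e. the $(\mu,\nu)$ block of $P^T\tilde A^{(r)}P$, is a block $d\times d$ circulant matrix. (3) If $r$ is a multiple of $\gamma$, then the $\tilde A^{(r)}_{\mu\mu}$ are circulant Kleene stars, where all off-diagonal entries are strictly less than $1$.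
   Context: Max algebra: on $\mathbb{R}_+=[0,\infty)$ put $a\oplus b=\max(a,b)$, $a\otimes b=ab$, extended to matrices by $(A\oplus B)_{ij}=\max(a_{ij},b_{ij})$, $(A\otimes B)_{ij}=\max_k a_{ik}b_{kj}$; $A^k$ is the $k$-th max-algebraic power ($A^0=I$), with entries $a^{(k)}_{ij}$. The digraph $\mathcal{D}(A)$ has nodes $1,\dots,n$ and an edge $(i,j)$ of weight $a_{ij}$ iff $a_{ij}\neq 0$; the weight of a path is the product of its edge weights, and the geometric mean of a cycle with $k$ edges is its weight to the power $1/k$. $\lambda(A)$ is the maximum cycle geometric mean. $A$ is definite if $\lambda(A)=1$, and irreducible if for all nodes $i,j$ there is a path in $\mathcal{D}(A)$ from $i$ to $j$. A cycle is critical if its geometric mean equals $\lambda(A)$; the critical graph $\mathcal{C}(A)=(N_c(A),E_c(A))$ consists of all nodes and edges belonging to critical cycles. A definite $A$ is visualized if $a_{ij}\le1$ for all $i,j$ and $a_{ij}=1$ for all $(i,j)\in E_c(A)$. $\mathcal{C}(A)$ has pairwise disjoint strongly connected components $\mathcal{C}_\mu$, $\mu=1,\dots,n_c$, with node sets $N_\mu$ and cyclicities $\gamma_\mu$ (gcd of cycle lengths); $\gamma=\operatorname{lcm}_\mu\gamma_\mu$. For nodes of the same $\mathcal{C}_\mu$, $i\sim j$ if there is a path in $\mathcal{C}_\mu$ from $i$ to $j$ of length $\equiv0\pmod{\gamma_\mu}$; the equivalence classes are the cyclic classes ($\gamma_\mu$ of them in $\mathcal{C}_\mu$), and $[i]\to_t[j]$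 means there is a path in $\mathcal{C}_\mu$ from a node of $[i]$ to a node of $[j]$ of length $\equiv t\pmod{\gamma_\mu}$. Each non-critical node is regarded as a "non-critical component" $\mathcal{C}_\mu$, $\mu=n_c+1,\dots,n_c+\bar c$ ($\bar c$ the number of non-critical nodes), with a single "cyclic class"; $\mu$ is called critical if $\mu\le n_c$. For a definite $B$, $B^*=I\oplus B\oplus\dots\oplus B^{n-1}$ and $Q(B)$ has entries $q_{ij}=\bigoplus_{k\in N_c(B)}b^*_{ik}b^*_{kj}$. The transient $T(A)$ is an integer such that $A^{t\gamma}=Q(A^\gamma)$ whenever $t\gamma\ge T(A)$, and $A^{r+\gamma}=A^r$ for all $r\ge T(A)$ (it exists for irreducible definite $A$). Reduced powers: for visualized $A$ and $r\ge T(A)$, rows (columns) of $A^r$ with indices in the same cyclic class coincide, so for all $\mu,\nu$ the block of $A^r$ with rows in $N_\mu$ and columns in $N_\nu$ is partitioned, according to the cyclic classes $s_1,\dots,s_k$ of $\mathcal{C}_\mu$ and $t_1,\dots,t_m$ of $\mathcal{C}_\nu$ (for critical components $k=\gamma_\mu$, $m=\gamma_\nu$, and the classes are arranged so that $s_1\to_1s_2\to_1\dots\to_1s_k\to_1s_1$, and similarly for the $t_j$), into constant subblocks $\tilde a^{(r)}_{s_it_j}E_{s_it_j}$, where $E_{s_it_j}$ is an all-ones matrix. $\tilde A^{(r)}$ is the $(\tilde c+\bar c)\times(\tilde c+\bar c)$ matrix of the scalars $\tilde a^{(r)}_{s_it_j}$, where $\tilde c$ is the total number of cyclic classes of $\mathcal{C}(A)$,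 and $\tilde A^{(r)}_{\mu\nu}=(\tilde a^{(r)}_{s_it_j})_{i\le k,\,j\le m}$. A matrix $B\in\mathbb{R}_+^{m\times n}$ is a rectangular circulant if $b_{ij}=b_{ps}$ whenever $p\equiv i+t\pmod m$ and $s\equiv j+t\pmod n$, for all $i,j,t$; for $m=n$ it is a circulant (i.e. $b_{ij}$ depends only on $j-i$ mod $n$). $B$ is a block $k\times k$ circulant if there are scalars $\alpha_1,\dots,\alpha_k$ and a block decomposition $B=(B_{ij})$, $i,j=1,\dots,k$, such that $B_{ij}=\alpha_eE_{ij}$ if $j-i\equiv e\pmod k$, where $E_{ij}$ are all-ones blocks. A square matrix $B$ is a Kleene star iff $B\otimes B=B$ and $b_{ii}=1$ for all $i$. *)

theory Defs
  imports
    Complex_Main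
    "HOL-Number_Theory.Cong"
    "Graph_Theory.Digraph_Component"
    "Jordan_Normal_Form.Matrix"
    "Jordan_Normal_Form.DL_Submatrix"
begin

section \<open>Max algebra\<close>

text \<open>Everything lives on the nonnegative reals, so the empty max-algebraic sum is 0 and including 0
  in the maximum does not change any nonempty one. Indices are 0-based throughout.\<close>

definition max_sum :: "('a \<Rightarrow> real) \<Rightarrow> 'a set \<Rightarrow> real" where
  "max_sum f S = Max (insert 0 (f ` S))"

definition max_mult :: "real mat \<Rightarrow> real mat \<Rightarrow> real mat" where
  "max_mult A B = mat (dim_row A) (dim_col B)
     (\<lambda>(i, j). max_sum (\<lambda>k. A $$ (i, k) * B $$ (k, j)) {..<dim_col A})"

primrec max_pow :: "real mat \<Rightarrow> nat \<Rightarrow> real mat" where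
  "max_pow A 0 = 1\<^sub>m (dim_row A)"
| "max_pow A (Suc k) = max_mult A (max_pow A k)"

definition kleene_closure :: "real mat \<Rightarrow> real mat" where
  "kleene_closure B = mat (dim_row B) (dim_col B)
     (\<lambda>(i, j). max_sum (\<lambda>k. max_pow B k $$ (i, j)) {..<dim_row B})"

definition kleene_star :: "real mat \<Rightarrow> bool" where
  "kleene_star B \<longleftrightarrow> square_mat B \<and> max_mult B B = B \<and> (\<forall>i<dim_row B. B $$ (i, i) = 1)"


section \<open>The associated digraph and the critical graph\<close>

definition mat_digraph :: "real mat \<Rightarrow> (nat, nat \<times> nat) pre_digraph" where
  "mat_digraph A = \<lparr> verts = {..<dim_row A},
     arcs = {(i, j). i < dim_row A \<and> j < dim_col A \<and> A $$ (i, j) \<noteq> 0}, tail = fst, head = snd \<rparr>"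

definition path_weight :: "real mat \<Rightarrow> (nat \<times> nat) list \<Rightarrow> real" where
  "path_weight A p = prod_list (map (\<lambda>e. A $$ e) p)"

definition geometric_mean :: "real mat \<Rightarrow> (nat \<times> nat) list \<Rightarrow> real" where
  "geometric_mean A p = root (length p) (path_weight A p)"

text \<open>Library cycles are elementary (no repeated nodes) and may be loops. There are finitely many
  of them, and they give the same maximum cycle mean, critical graph and cyclicities as arbitrary
  closed walks. The value is 0 if there is no cycle.\<close>

definition max_cycle_mean :: "real mat \<Rightarrow> real" where
  "max_cycle_mean A = max_sum (geometric_mean A) {p. pre_digraph.cycle (mat_digraph A) p}"

definition irreducible_mat :: "real mat \<Rightarrow> bool" where
  "irreducible_mat A \<longleftrightarrow> strongly_connected (mat_digraph A)"

definition definite_mat :: "real mat \<Rightarrow> bool" where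
  "definite_mat A \<longleftrightarrow> max_cycle_mean A = 1"

definition critical_cycle :: "real mat \<Rightarrow> (nat \<times> nat) list \<Rightarrow> bool" where
  "critical_cycle A p \<longleftrightarrow>
     pre_digraph.cycle (mat_digraph A) p \<and> geometric_mean A p = max_cycle_mean A"

definition critical_edges :: "real mat \<Rightarrow> (nat \<times> nat) set" where
  "critical_edges A = (\<Union>p\<in>{p. critical_cycle A p}. set p)"

definition critical_nodes :: "real mat \<Rightarrow> nat set" where
  "critical_nodes A = fst ` critical_edges A \<union> snd ` critical_edges A"

definition critical_graph :: "real mat \<Rightarrow> (nat, nat \<times> nat) pre_digraph" where
  "critical_graph A =
     \<lparr> verts = critical_nodes A, arcs = critical_edges A, tail = fst, head = snd \<rparr>"

definition visualized :: "real mat \<Rightarrow> bool" where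
  "visualized A \<longleftrightarrow> definite_mat A \<and>
     (\<forall>i<dim_row A. \<forall>j<dim_col A. A $$ (i, j) \<le> 1) \<and>
     (\<forall>e\<in>critical_edges A. A $$ e = 1)"


section \<open>Cyclicity and cyclic classes\<close>

definition cyclicity :: "(nat, nat \<times> nat) pre_digraph \<Rightarrow> nat" where
  "cyclicity C = Gcd {length p | p. pre_digraph.cycle C p}"

definition crit_components :: "real mat \<Rightarrow> (nat, nat \<times> nat) pre_digraph set" where
  "crit_components A = pre_digraph.sccs (critical_graph A)"

definition total_cyclicity :: "real mat \<Rightarrow> nat" where
  "total_cyclicity A = Lcm (cyclicity ` crit_components A)"

definition cyclic_rel :: "(nat, nat \<times> nat) pre_digraph \<Rightarrow> (nat \<times> nat) set" where
  "cyclic_rel C = {(i, j). i \<in> verts C \<and> j \<in> verts C \<and>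
     (\<exists>p. pre_digraph.awalk C i p j \<and> [length p = 0] (mod cyclicity C))}"

definition cyclic_classes :: "(nat, nat \<times> nat) pre_digraph \<Rightarrow> nat set set" where
  "cyclic_classes C = verts C // cyclic_rel C"

definition class_access :: "(nat, nat \<times> nat) pre_digraph \<Rightarrow> nat \<Rightarrow> nat set \<Rightarrow> nat set \<Rightarrow> bool" where
  "class_access C t S S' \<longleftrightarrow>
     (\<exists>i\<in>S. \<exists>j\<in>S'. \<exists>p. pre_digraph.awalk C i p j \<and> [length p = t] (mod cyclicity C))"


section \<open>The transient\<close>

definition Q_mat :: "real mat \<Rightarrow> real mat" where
  "Q_mat B = mat (dim_row B) (dim_col B)
     (\<lambda>(i, j). max_sum (\<lambda>k. kleene_closure B $$ (i, k) * kleene_closure B $$ (k, j))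
        (critical_nodes B))"

definition is_transient :: "real mat \<Rightarrow> nat \<Rightarrow> bool" where
  "is_transient A T \<longleftrightarrow>
     (\<forall>t. t * total_cyclicity A \<ge> T \<longrightarrow>
        max_pow A (t * total_cyclicity A) = Q_mat (max_pow A (total_cyclicity A))) \<and>
     (\<forall>r\<ge>T. max_pow A (r + total_cyclicity A) = max_pow A r)"


section \<open>Reduced powers\<close>

text \<open>The list \<open>Cs\<close> enumerates the components of the critical graph; \<open>css ! \<mu>\<close> lists
  the cyclic classes of the component with number \<open>\<mu>\<close>. The critical components come first, with
  their classes in cyclic order (the starting class is arbitrary); then every non-critical node
  follows as a component with a single class. The flattened list \<open>concat css\<close> numbers the rows
  and columns of the reduced powers.\<close>

definition class_arrangement ::
  "real mat \<Rightarrow> (nat, nat \<times> nat) pre_digraph list \<Rightarrow> nat set list list \<Rightarrow> bool" where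
  "class_arrangement A Cs css \<longleftrightarrow>
     distinct Cs \<and> set Cs = crit_components A \<and> length Cs \<le> length css \<and>
     (\<forall>\<mu><length Cs. distinct (css ! \<mu>) \<and> set (css ! \<mu>) = cyclic_classes (Cs ! \<mu>) \<and>
        (\<forall>i<length (css ! \<mu>).
           class_access (Cs ! \<mu>) 1 (css ! \<mu> ! i) (css ! \<mu> ! (Suc i mod length (css ! \<mu>))))) \<and>
     (\<exists>ns. distinct ns \<and> set ns = {..<dim_row A} - critical_nodes A \<and>
        drop (length Cs) css = map (\<lambda>i. [{i}]) ns)"

definition reduced_power :: "real mat \<Rightarrow> nat set list list \<Rightarrow> nat \<Rightarrow> real mat" where
  "reduced_power A css r =
     mat (length (concat css)) (length (concat css))
       (\<lambda>(p, q). THE a. \<forall>i\<in>concat css ! p. \<forall>j\<in>concat css ! q. max_pow A r $$ (i, j) = a)"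

definition comp_indices :: "nat set list list \<Rightarrow> nat \<Rightarrow> nat set" where
  "comp_indices css \<mu> =
     {length (concat (take \<mu> css)) ..< length (concat (take (Suc \<mu>) css))}"

definition comp_block :: "nat set list list \<Rightarrow> real mat \<Rightarrow> nat \<Rightarrow> nat \<Rightarrow> real mat" where
  "comp_block css M \<mu> \<nu> = submatrix M (comp_indices css \<mu>) (comp_indices css \<nu>)"


section \<open>Circulants and permutation matrices\<close>

definition rect_circulant :: "real mat \<Rightarrow> bool" where
  "rect_circulant B \<longleftrightarrow>
     (\<forall>i<dim_row B. \<forall>p<dim_row B. \<forall>j<dim_col B. \<forall>s<dim_col B. \<forall>t::int.
        [int p = int i + t] (mod int (dim_row B)) \<and> [int s = int j + t] (mod int (dim_col B))
        \<longrightarrow> B $$ (i, j) = B $$ (p, s))"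

definition circulant :: "real mat \<Rightarrow> bool" where
  "circulant B \<longleftrightarrow> square_mat B \<and> rect_circulant B"

text \<open>Block row \<open>i\<close> consists of the rows \<open>\<rho> i, \<dots>, \<rho> (i + 1) - 1\<close>, and likewise for columns with
  \<open>\<kappa>\<close>; all blocks are nonempty.\<close>

definition block_circulant :: "nat \<Rightarrow> real mat \<Rightarrow> bool" where
  "block_circulant k B \<longleftrightarrow>
     (\<exists>(\<alpha> :: nat \<Rightarrow> real) (\<rho> :: nat \<Rightarrow> nat) (\<kappa> :: nat \<Rightarrow> nat).
        \<rho> 0 = 0 \<and> \<rho> k = dim_row B \<and> (\<forall>i<k. \<rho> i < \<rho> (Suc i)) \<and>
        \<kappa> 0 = 0 \<and> \<kappa> k = dim_col B \<and> (\<forall>j<k. \<kappa> j < \<kappa> (Suc j)) \<and>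
        (\<forall>i<k. \<forall>j<k. \<forall>e\<in>{1..k}. [int j - int i = int e] (mod int k) \<longrightarrow>
           (\<forall>p\<in>{\<rho> i..<\<rho> (Suc i)}. \<forall>q\<in>{\<kappa> j..<\<kappa> (Suc j)}. B $$ (p, q) = \<alpha> e)))"

definition permutation_matrix :: "nat \<Rightarrow> real mat \<Rightarrow> bool" where
  "permutation_matrix N P \<longleftrightarrow> P \<in> carrier_mat N N \<and>
     (\<forall>i<N. \<forall>j<N. P $$ (i, j) \<in> {0, 1}) \<and>
     (\<forall>i<N. \<exists>!j. j < N \<and> P $$ (i, j) = 1) \<and>
     (\<forall>j<N. \<exists>!i. i < N \<and> P $$ (i, j) = 1)"

text \<open>The \<open>(\<mu>, \<nu>)\<close> block of a conjugate \<open>P\<^sup>T M P\<close> is meaningful only if \<open>P\<close> moves indices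
  within components.\<close>

definition respects_components :: "nat set list list \<Rightarrow> real mat \<Rightarrow> bool" where
  "respects_components css P \<longleftrightarrow>
     (\<forall>p<dim_row P. \<forall>q<dim_col P. P $$ (p, q) \<noteq> 0 \<longrightarrow>
        (\<forall>\<mu><length css. p \<in> comp_indices css \<mu> \<longleftrightarrow> q \<in> comp_indices css \<mu>))"

end

theory Submission
  imports Defs "HOL-Combinatorics.Permutations"
begin

text \<open>For a visualized matrix, \<open>A\<^sup>k\<close> has entry 1 at \<open>(i, j)\<close> exactly if there is a walk of length \<open>k\<close>
  from \<open>i\<close> to \<open>j\<close> all of whose arcs have weight 1, and walks in the critical graph are of this kind.
  In a strongly connected component of cyclicity \<open>\<gamma>\<close>, walks of every sufficiently large length in the
  right residue class modulo \<open>\<gamma>\<close> exist. Prefixing and suffixing critical walks of residues \<open>-t\<close> and \<open>t\<close>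
  with total length a multiple of the total cyclicity shows, by periodicity, that \<open>A\<^sup>r\<close> does not
  change when both indices are moved \<open>t\<close> steps along the cyclic classes. This is the rectangular
  circulant property. By Bezout, an entry of such a \<open>k \<times> m\<close> matrix depends only on \<open>j - i\<close> modulo
  \<open>gcd k m\<close>, so sorting the indices by this residue gives the block circulant. Conversely a walk of
  weight-1 arcs between two nodes of one component closes up to a critical cycle, hence stays in the
  component; so an entry 1 of \<open>A\<^sup>r\<close> with \<open>\<gamma>\<close> dividing \<open>r\<close> forces the two classes to be equal.\<close>

section \<open>Walk lengths and cyclic classes\<close>

text \<open>For \<open>S\<close> other than \<open>{0}\<close>, the least positive difference
  \<open>m\<close> of two elements of \<open>S\<close> divides every element of \<open>S\<close>.
  Two positive elements \<open>b'\<close> and \<open>b' + m\<close> then already generate all large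
  multiples of \<open>m\<close>.\<close>

lemma add_closed_contains_large_multiples:
  fixes S :: "nat set"
  assumes zero: "0 \<in> S" and add: "\<And>a b. a \<in> S \<Longrightarrow> b \<in> S \<Longrightarrow> a + b \<in> S"
  shows "\<exists>N. \<forall>L\<ge>N. Gcd S dvd L \<longrightarrow> L \<in> S"
proof (cases "S = {0}")
  case True
  then show ?thesis by auto
next
  case False
  then obtain s where s: "s \<in> S" "s > 0" using zero by blast
  have mult: "q * a \<in> S" if "a \<in> S" for q a
    using that by (induction q) (auto intro: zero add)
  define P where "P m \<longleftrightarrow> m > 0 \<and> (\<exists>b\<in>S. b + m \<in> S)" for m
  have "P s" using s zero unfolding P_def by force
  define m where "m = (LEAST m. P m)"
  have "P m" unfolding m_def using \<open>P s\<close> by (rule LeastI)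
  then obtain b where b: "m > 0" "b \<in> S" "b + m \<in> S" unfolding P_def by blast
  have dvd: "m dvd a" if "a \<in> S" for a
  proof (rule ccontr)
    assume "\<not> m dvd a"
    then have pos: "a mod m > 0" by (simp add: mod_greater_zero_iff_not_dvd)
    \<comment> \<open>Two elements of \<open>S\<close> differ by the remainder
      \<open>a mod m\<close>, so a nonzero remainder would contradict the minimality of
      \<open>m\<close>.\<close>
    have "(a div m) * (b + m) + a mod m = a + (a div m) * b"
      by (simp add: algebra_simps)
    moreover have "a + (a div m) * b \<in> S" "(a div m) * (b + m) \<in> S"
      using that b by (auto intro: add mult)
    ultimately have "P (a mod m)" unfolding P_def using pos by metis
    then have "m \<le> a mod m" unfolding m_def by (rule Least_le)
    with b(1) show False by (metis mod_less_divisor not_le)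
  qed
  then have "m dvd Gcd S" by (rule Gcd_greatest)
  \<comment> \<open>Adding \<open>s\<close> makes the smaller element of the pair positive, which
    gives \<open>c > 0\<close> below.\<close>
  define b' where "b' = b + s"
  have b': "b' \<in> S" "b' + m \<in> S" "b' > 0"
    using b s add[of "b + m" s] by (auto simp: b'_def add ac_simps)
  then obtain c where c: "b' = m * c" using dvd by blast
  with b'(3) have "c > 0" by auto
  have "L \<in> S" if L: "L \<ge> m * (c * c)" "Gcd S dvd L" for L
  proof -
    obtain l where l: "L = m * l" using L(2) \<open>m dvd Gcd S\<close> by (meson dvd_trans dvdE)
    have "l \<ge> c * c" using L(1) b(1) l by simp
    then have "l div c \<ge> c" using \<open>c > 0\<close> by (metis div_le_mono nonzero_mult_div_cancel_right not_gr_zero)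
    moreover have "l mod c < c" using \<open>c > 0\<close> by simp
    \<comment> \<open>Because of \<open>l \<ge> c * c\<close> the quotient exceeds the remainder.
      The surplus \<open>e\<close> becomes the coefficient of \<open>b'\<close>, the remainder that
      of \<open>b' + m\<close>.\<close>
    ultimately obtain e where e: "l div c = l mod c + e"
      by (metis le_add_diff_inverse less_imp_le order_trans)
    have "L = m * (l div c * c + l mod c)" using l by simp
    also have "\<dots> = e * b' + (l mod c) * (b' + m)"
      unfolding e c by (simp add: algebra_simps)
    finally show ?thesis using b' by (auto intro: add mult)
  qed
  then show ?thesis by blast
qed

text \<open>A closed walk that is not a cycle contains a proper closed subwalk. Cutting it out
  leaves two shorter closed walks, to which the induction hypothesis applies.\<close>

lemma closed_walk_length_dvd:
  assumes "wf_digraph G" and "pre_digraph.awalk G u p u"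
  shows "cyclicity G dvd length p"
  using assms(2)
proof (induction "length p" arbitrary: u p rule: less_induct)
  case less
  interpret wf_digraph G by fact
  show ?case
  proof (cases p)
    case Nil
    then show ?thesis by simp
  next
    case (Cons e es)
    show ?thesis
    proof (cases "distinct (tl (awalk_verts u p))")
      case True
      then have "cycle p" using less.prems Cons unfolding cycle_def by blast
      then show ?thesis unfolding cyclicity_def by (auto intro: Gcd_dvd)
    next
      case False
      \<comment> \<open>The start node always recurs at the end, so repetitions are sought only
        after the first arc. As \<open>e\<close> stays outside \<open>r\<close>, both closed walks
        are strictly shorter than \<open>p\<close>.\<close>
      have es: "awalk (head G e) es u" "awalk u [e] (head G e)"
        using less.prems Cons by (auto simp: awalk_simps)
      have "\<not> distinct (awalk_verts (head G e) es)" using False Cons by simp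
      then obtain q r s w where qrs: "es = q @ r @ s" "0 < length r"
        "awalk (head G e) q w" "awalk w r w" "awalk w s u"
        using awalk_not_distinct_decomp[OF es(1)] by blast
      have "awalk u ([e] @ q @ s) u" using es qrs by (meson awalk_appendI)
      then have "cyclicity G dvd length ([e] @ q @ s)"
        using qrs(1,2) Cons by (intro less.hyps) auto
      moreover have "cyclicity G dvd length r"
        using qrs Cons by (intro less.hyps) auto
      ultimately have "cyclicity G dvd length ([e] @ q @ s) + length r" by (rule dvd_add)
      then show ?thesis using Cons qrs(1) by (simp add: ac_simps)
    qed
  qed
qed

section \<open>Strongly connected digraphs: large walk lengths and cyclic classes\<close>

locale strong_digraph = wf_digraph G for G :: "(nat, nat \<times> nat) pre_digraph" +
  assumes strong: "strongly_connected G"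
begin

lemma ex_awalk: "u \<in> verts G \<Longrightarrow> v \<in> verts G \<Longrightarrow> \<exists>p. awalk u p v"
  using strong reachable_awalk by (auto simp: strongly_connected_def)

text \<open>The lengths of closed walks at \<open>u\<close> form an additive set whose gcd divides
  the cyclicity. Hence \<open>q\<close> can be preceded by closed walks of every large length
  divisible by the cyclicity.\<close>

lemma ex_awalk_of_large_length:
  assumes "awalk u q v"
  shows "\<exists>N. \<forall>L\<ge>N. [L = length q] (mod cyclicity G) \<longrightarrow> (\<exists>p. awalk u p v \<and> length p = L)"
proof -
  define S where "S = {length p | p. awalk u p u}"
  have u: "u \<in> verts G" using assms by blast
  have "awalk u [] u" using u by (simp add: awalk_Nil_iff)
  then have "0 \<in> S" unfolding S_def by force
  moreover have "a + b \<in> S" if "a \<in> S" "b \<in> S" for a b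
    using that unfolding S_def by (smt (verit) awalk_appendI length_append mem_Collect_eq)
  ultimately obtain N where N: "\<forall>L\<ge>N. Gcd S dvd L \<longrightarrow> L \<in> S"
    using add_closed_contains_large_multiples by blast
  have closed: "Gcd S dvd length p" if "awalk u p u" for p
    using that unfolding S_def by (auto intro: Gcd_dvd)
  have "Gcd S dvd length c" if cyc: "cycle c" for c
  proof -
    obtain v where v: "awalk v c v" using cyc unfolding cycle_def by blast
    then obtain p1 p2 where p: "awalk u p1 v" "awalk v p2 u" using ex_awalk u by blast
    \<comment> \<open>Inserting the cycle \<open>c\<close> into a closed walk at \<open>u\<close>
      changes its length by exactly \<open>length c\<close>.\<close>
    have "Gcd S dvd length (p1 @ p2)" "Gcd S dvd length (p1 @ c @ p2)"
      using p v by (meson closed awalk_appendI)+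
    then show ?thesis by (simp add: dvd_add_right_iff) (metis add.commute add.left_commute dvd_add_right_iff)
  qed
  then have "Gcd S dvd cyclicity G" unfolding cyclicity_def by (auto intro: Gcd_greatest)
  have "\<exists>p. awalk u p v \<and> length p = L"
    if "L \<ge> N + length q" "[L = length q] (mod cyclicity G)" for L
  proof -
    have "cyclicity G dvd L - length q"
      using that by (metis add_leE cong_altdef_nat)
    then have "L - length q \<in> S"
      using N that(1) \<open>Gcd S dvd cyclicity G\<close> by (meson add_le_imp_le_diff dvd_trans)
    then obtain c where "awalk u c u" "length c = L - length q" unfolding S_def by force
    then have "awalk u (c @ q) v" "length (c @ q) = L"
      using assms that(1) by (auto intro: awalk_appendI)
    then show ?thesis by blast
  qed
  then show ?thesis by blast
qed

lemma cyclic_rel_refl: "x \<in> verts G \<Longrightarrow> (x, x) \<in> cyclic_rel G"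
  unfolding cyclic_rel_def by (auto intro!: exI[of _ "[]"] simp: awalk_Nil_iff)

lemma equiv_cyclic_rel: "equiv (verts G) (cyclic_rel G)"
proof (rule equivI)
  show "cyclic_rel G \<subseteq> verts G \<times> verts G" unfolding cyclic_rel_def by blast
  show "refl_on (verts G) (cyclic_rel G)"
    by (auto simp: refl_on_def cyclic_rel_refl)
  show "sym (cyclic_rel G)"
  proof (rule symI)
    fix x y assume "(x, y) \<in> cyclic_rel G"
    then obtain p where xy: "x \<in> verts G" "y \<in> verts G" "awalk x p y"
      "[length p = 0] (mod cyclicity G)" unfolding cyclic_rel_def by blast
    \<comment> \<open>The return walk \<open>q\<close> closes \<open>p\<close> up, so the total
      length, and with it the length of \<open>q\<close>, is divisible by the cyclicity.\<close>
    obtain q where q: "awalk y q x" using ex_awalk xy by blast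
    have "cyclicity G dvd length (p @ q)"
      using closed_walk_length_dvd[OF wf_digraph_axioms] xy q by (meson awalk_appendI)
    then have "[length q = 0] (mod cyclicity G)"
      using xy(4) by (simp add: cong_0_iff dvd_add_right_iff)
    then show "(y, x) \<in> cyclic_rel G" using xy q unfolding cyclic_rel_def by blast
  qed
  show "trans (cyclic_rel G)"
  proof (rule transI)
    fix x y z assume "(x, y) \<in> cyclic_rel G" "(y, z) \<in> cyclic_rel G"
    then obtain p q where *: "awalk x p y" "awalk y q z" "x \<in> verts G" "z \<in> verts G"
      "[length p = 0] (mod cyclicity G)" "[length q = 0] (mod cyclicity G)"
      unfolding cyclic_rel_def by blast
    then have "awalk x (p @ q) z" "[length (p @ q) = 0] (mod cyclicity G)"
      by (auto simp: cong_0_iff intro: awalk_appendI)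
    then show "(x, z) \<in> cyclic_rel G" using * unfolding cyclic_rel_def by blast
  qed
qed

end

text \<open>The length of \<open>cs\<close> is left open here; that it equals the cyclicity is
  derived in \<open>length_cs\<close>.\<close>

locale arranged_component = strong_digraph +
  fixes cs :: "nat set list"
  assumes cyclicity_pos: "cyclicity G > 0"
    and distinct_cs: "distinct cs"
    and set_cs: "set cs = cyclic_classes G"
    and access: "\<And>i. i < length cs \<Longrightarrow> class_access G 1 (cs ! i) (cs ! (Suc i mod length cs))"
begin

lemma nth_class: "i < length cs \<Longrightarrow> cs ! i \<in> verts G // cyclic_rel G"
  using set_cs nth_mem unfolding cyclic_classes_def by blast

lemma class_nonempty: "i < length cs \<Longrightarrow> cs ! i \<noteq> {}"
  using nth_class in_quotient_imp_non_empty[OF equiv_cyclic_rel] by blast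

lemma class_subset: "i < length cs \<Longrightarrow> cs ! i \<subseteq> verts G"
  using nth_class in_quotient_imp_subset[OF equiv_cyclic_rel] by blast

lemma same_class_iff:
  assumes "i < length cs" "j < length cs" "x \<in> cs ! i" "y \<in> cs ! j"
  shows "i = j \<longleftrightarrow> (\<exists>p. awalk x p y \<and> [length p = 0] (mod cyclicity G))"
proof -
  have "i = j \<longleftrightarrow> cs ! i = cs ! j" using distinct_cs assms by (simp add: nth_eq_iff_index_eq)
  also have "\<dots> \<longleftrightarrow> (x, y) \<in> cyclic_rel G"
    using quotient_eq_iff[OF equiv_cyclic_rel] nth_class assms by blast
  also have "\<dots> \<longleftrightarrow> (\<exists>p. awalk x p y \<and> [length p = 0] (mod cyclicity G))"
    unfolding cyclic_rel_def by blast
  finally show ?thesis .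
qed

text \<open>\<open>access\<close> links only some representatives of consecutive classes. The
  induction hypothesis reaches the first of them, and a walk of residue 0 leads from the second to
  \<open>y\<close>.\<close>

lemma ex_awalk_shift:
  assumes "i < length cs" "x \<in> cs ! i" "y \<in> cs ! ((i + l) mod length cs)"
  shows "\<exists>p. awalk x p y \<and> [length p = l] (mod cyclicity G)"
  using assms(3)
proof (induction l arbitrary: y)
  case 0
  then show ?case using same_class_iff[of i i x y] assms by simp
next
  case (Suc l)
  define j where "j = (i + l) mod length cs"
  have j: "j < length cs" "Suc j mod length cs = (i + Suc l) mod length cs"
    using assms(1) by (auto simp: j_def mod_simps intro: mod_less_divisor)
  obtain y' z q where q: "y' \<in> cs ! j" "z \<in> cs ! ((i + Suc l) mod length cs)"
    "awalk y' q z" "[length q = 1] (mod cyclicity G)"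
    using access[OF j(1)] unfolding j(2) class_access_def by blast
  obtain p where p: "awalk x p y'" "[length p = l] (mod cyclicity G)"
    using Suc.IH q(1) unfolding j_def by blast
  obtain s where s: "awalk z s y" "[length s = 0] (mod cyclicity G)"
    using same_class_iff[OF _ _ q(2) Suc.prems] j by (metis mod_less_divisor less_nat_zero_code not_gr_zero)
  have "awalk x (p @ q @ s) y" using p q s by (meson awalk_appendI)
  moreover have "[length (p @ q @ s) = Suc l] (mod cyclicity G)"
    using cong_add[OF p(2) cong_add[OF q(4) s(2)]] by simp
  ultimately show ?case by blast
qed

text \<open>One tour around the list returns to the starting class, so the cyclicity divides the
  length. In a longer list the classes at positions 0 and \<open>cyclicity G\<close> would be joined
  by a walk of residue 0 and coincide, against distinctness.\<close>

lemma length_cs: "length cs = cyclicity G"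
proof -
  obtain v where "v \<in> verts G" using strong unfolding strongly_connected_def by blast
  then have "cyclic_rel G `` {v} \<in> set cs" using set_cs unfolding cyclic_classes_def by (simp add: quotientI)
  then have pos: "length cs > 0" by (cases cs) auto
  then obtain x where x: "x \<in> cs ! 0" using class_nonempty by blast
  have "\<exists>p. awalk x p x \<and> [length p = length cs] (mod cyclicity G)"
    using x pos by (intro ex_awalk_shift[of 0]) auto
  then have "cyclicity G dvd length cs"
    using closed_walk_length_dvd[OF wf_digraph_axioms] by (metis cong_dvd_iff dvd_refl cong_0_iff cong_sym cong_trans)
  moreover have "\<not> cyclicity G < length cs"
  proof
    assume less: "cyclicity G < length cs"
    then obtain y where y: "y \<in> cs ! cyclicity G" using class_nonempty by blast
    have "\<exists>p. awalk x p y \<and> [length p = cyclicity G] (mod cyclicity G)"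
      using x y pos less by (intro ex_awalk_shift[of 0]) auto
    then have "\<exists>p. awalk x p y \<and> [length p = 0] (mod cyclicity G)"
      by (simp add: cong_def)
    then show False using same_class_iff[OF pos less x y] cyclicity_pos by simp
  qed
  ultimately show ?thesis using pos by (metis dvd_imp_le le_neq_implies_less)
qed

lemma ex_awalk_between:
  assumes "i < cyclicity G" "j < cyclicity G" "x \<in> cs ! i" "y \<in> cs ! j"
  shows "\<exists>p. awalk x p y \<and> [int i + int (length p) = int j] (mod int (cyclicity G))"
proof -
  \<comment> \<open>Adding the cyclicity before subtracting \<open>i\<close> keeps the subtraction
    on naturals exact.\<close>
  have "(i + (j + cyclicity G - i)) mod length cs = j"
    using assms(1,2) by (simp add: length_cs)
  then obtain p where "awalk x p y" "[length p = j + cyclicity G - i] (mod cyclicity G)"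
    using ex_awalk_shift assms length_cs by metis
  moreover from this(2) have "[i + length p = i + (j + cyclicity G - i)] (mod cyclicity G)"
    by (simp add: cong_add_lcancel_nat)
  then have "[i + length p = j] (mod cyclicity G)"
    using assms(1) by (simp add: cong_def)
  then have "[int i + int (length p) = int j] (mod int (cyclicity G))"
    by (metis cong_int_iff of_nat_add)
  ultimately show ?thesis by blast
qed

end

section \<open>Max-algebraic powers and critical walks\<close>

lemma le_max_sum: "finite S \<Longrightarrow> k \<in> S \<Longrightarrow> f k \<le> max_sum f S"
  unfolding max_sum_def by (intro Max_ge) auto

lemma max_sum_nonneg: "finite S \<Longrightarrow> 0 \<le> max_sum f S"
  unfolding max_sum_def by (intro Max_ge) auto

lemma max_sum_le: "finite S \<Longrightarrow> 0 \<le> c \<Longrightarrow> (\<And>k. k \<in> S \<Longrightarrow> f k \<le> c) \<Longrightarrow> max_sum f S \<le> c"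
  unfolding max_sum_def by (subst Max_le_iff) auto

lemma max_sum_attained:
  assumes "finite S" "max_sum f S > 0"
  shows "\<exists>k\<in>S. f k = max_sum f S"
proof -
  have "max_sum f S \<in> insert 0 (f ` S)"
    unfolding max_sum_def using assms(1) by (intro Max_in) auto
  then show ?thesis using assms(2) by auto
qed

lemma max_sum_eq_single:
  assumes "finite S" "k \<in> S" "0 \<le> f k" "\<And>j. j \<in> S \<Longrightarrow> j \<noteq> k \<Longrightarrow> f j = 0"
  shows "max_sum f S = f k"
proof (rule antisym)
  show "max_sum f S \<le> f k" using assms by (intro max_sum_le) (auto, metis order.refl)
qed (use assms in \<open>simp add: le_max_sum\<close>)

text \<open>For a visualized matrix this digraph contains the critical graph, and its cycles are all
  critical. Its walks are those that detect entries 1 of powers.\<close>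

definition unit_digraph :: "real mat \<Rightarrow> (nat, nat \<times> nat) pre_digraph" where
  "unit_digraph A = \<lparr> verts = {..<dim_row A},
     arcs = {(i, j). i < dim_row A \<and> j < dim_col A \<and> A $$ (i, j) = 1}, tail = fst, head = snd \<rparr>"

lemma cas_eq_if_same_ends:
  "tail G = tail H \<Longrightarrow> head G = head H \<Longrightarrow> pre_digraph.cas G = pre_digraph.cas H"
  by (rule compatible_cas) (simp add: compatible_def)

lemma awalk_mono:
  assumes "pre_digraph.awalk G u p v" "verts G \<subseteq> verts H" "arcs G \<subseteq> arcs H"
    "tail G = tail H" "head G = head H"
  shows "pre_digraph.awalk H u p v"
  using assms cas_eq_if_same_ends[OF assms(4,5)] unfolding pre_digraph.awalk_def by auto

lemma cycle_mono:
  assumes "pre_digraph.cycle G p" "verts G \<subseteq> verts H" "arcs G \<subseteq> arcs H"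
    "tail G = tail H" "head G = head H"
  shows "pre_digraph.cycle H p"
proof -
  have "pre_digraph.awalk_verts G = pre_digraph.awalk_verts H"
    using assms by (intro compatible_awalk_verts) (simp add: compatible_def)
  then show ?thesis
    using assms awalk_mono[OF _ assms(2-5)] unfolding pre_digraph.cycle_def by metis
qed

section \<open>Powers of a visualized matrix and walks of weight 1\<close>

locale visualized_matrix =
  fixes A :: "real mat" and n :: nat
  assumes carrier: "A \<in> carrier_mat n n"
    and nonneg: "\<And>i j. i < n \<Longrightarrow> j < n \<Longrightarrow> 0 \<le> A $$ (i, j)"
    and visualized: "visualized A"
begin

lemma dims [simp]: "dim_row A = n" "dim_col A = n"
  using carrier by auto

lemma le_one: "i < n \<Longrightarrow> j < n \<Longrightarrow> A $$ (i, j) \<le> 1"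
  using visualized by (auto simp: visualized_def)

lemma max_cycle_mean_one: "max_cycle_mean A = 1"
  using visualized by (simp add: visualized_def definite_mat_def)

lemma dim_max_pow [simp]: "dim_row (max_pow A k) = n" "dim_col (max_pow A k) = n"
  by (induction k) (auto simp: max_mult_def)

lemma max_pow_Suc_index:
  "i < n \<Longrightarrow> j < n \<Longrightarrow>
    max_pow A (Suc k) $$ (i, j) = max_sum (\<lambda>l. A $$ (i, l) * max_pow A k $$ (l, j)) {..<n}"
  by (simp add: max_mult_def)

lemma max_pow_nonneg: "i < n \<Longrightarrow> j < n \<Longrightarrow> 0 \<le> max_pow A k $$ (i, j)"
  by (cases k) (auto simp: max_pow_Suc_index max_sum_nonneg simp del: max_pow.simps(2))

lemma max_pow_le_one: "i < n \<Longrightarrow> j < n \<Longrightarrow> max_pow A k $$ (i, j) \<le> 1"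
proof (induction k arbitrary: i)
  case (Suc k)
  then show ?case
    by (auto simp: max_pow_Suc_index nonneg le_one max_pow_nonneg
        simp del: max_pow.simps(2) intro!: max_sum_le mult_le_one)
qed simp

text \<open>A positive entry of the left power is attained by some first arc, which can be put in
  front of the walks counted by the induction hypothesis. If the entry is 0, the product
  vanishes.\<close>

lemma max_pow_add_ge:
  assumes "i < n" "j < n" "k < n"
  shows "max_pow A a $$ (i, j) * max_pow A b $$ (j, k) \<le> max_pow A (a + b) $$ (i, k)"
  using assms(1)
proof (induction a arbitrary: i)
  case 0
  then show ?case using assms by (auto simp: max_pow_nonneg)
next
  case (Suc a)
  show ?case
  proof (cases "max_pow A (Suc a) $$ (i, j) > 0")
    case True
    then obtain l where l: "l < n" "A $$ (i, l) * max_pow A a $$ (l, j) = max_pow A (Suc a) $$ (i, j)"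
      using max_sum_attained[of "{..<n}" "\<lambda>l. A $$ (i, l) * max_pow A a $$ (l, j)"] Suc.prems assms
      by (auto simp: max_pow_Suc_index simp del: max_pow.simps(2))
    have "max_pow A (Suc a) $$ (i, j) * max_pow A b $$ (j, k)
        = A $$ (i, l) * (max_pow A a $$ (l, j) * max_pow A b $$ (j, k))"
      using l(2) by (metis mult.assoc)
    also have "\<dots> \<le> A $$ (i, l) * max_pow A (a + b) $$ (l, k)"
      using Suc l nonneg by (intro mult_left_mono) auto
    also have "\<dots> \<le> max_pow A (Suc (a + b)) $$ (i, k)"
      unfolding max_pow_Suc_index[OF Suc.prems assms(3)] using l(1)
      by (intro le_max_sum[of _ _ "\<lambda>l. A $$ (i, l) * max_pow A (a + b) $$ (l, k)"]) auto
    finally show ?thesis by simp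
  next
    case False
    then have "max_pow A (Suc a) $$ (i, j) = 0"
      using max_pow_nonneg[OF Suc.prems assms(2), of "Suc a"] by linarith
    then show ?thesis using max_pow_nonneg Suc.prems assms by (simp del: max_pow.simps(2))
  qed
qed

abbreviation "U \<equiv> unit_digraph A"

lemma U_simps [simp]: "verts U = {..<n}" "tail U = fst" "head U = snd"
  "arcs U = {(i, j). i < n \<and> j < n \<and> A $$ (i, j) = 1}"
  by (simp_all add: unit_digraph_def)

sublocale U: wf_digraph "unit_digraph A"
  by unfold_locales auto

text \<open>A product of two numbers in [0,1] equals 1 only if both factors do. Hence a maximum of 1
  is attained by a unit arc followed by a unit walk.\<close>

lemma max_pow_eq_one_iff:
  assumes "i < n" "j < n"
  shows "max_pow A k $$ (i, j) = 1 \<longleftrightarrow> (\<exists>p. U.awalk i p j \<and> length p = k)"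
  using assms(1)
proof (induction k arbitrary: i)
  case 0
  then show ?case using assms by (auto simp: U.awalk_Nil_iff)
next
  case (Suc k)
  let ?f = "\<lambda>l. A $$ (i, l) * max_pow A k $$ (l, j)"
  have le: "?f l \<le> 1" if "l < n" for l
    using that Suc.prems assms by (simp add: mult_le_one le_one nonneg max_pow_le_one max_pow_nonneg)
  have one: "?f l = 1 \<longleftrightarrow> A $$ (i, l) = 1 \<and> max_pow A k $$ (l, j) = 1" if "l < n" for l
    using that Suc.prems assms mult_left_le[of "max_pow A k $$ (l, j)" "A $$ (i, l)"]
      mult_left_le[of "A $$ (i, l)" "max_pow A k $$ (l, j)"]
      le_one[of i l] nonneg[of i l] max_pow_le_one[of l j k] max_pow_nonneg[of l j k]
    by (auto simp: mult.commute)
  have "max_pow A (Suc k) $$ (i, j) = 1 \<longleftrightarrow> (\<exists>l<n. ?f l = 1)"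
  proof
    assume "max_pow A (Suc k) $$ (i, j) = 1"
    then show "\<exists>l<n. ?f l = 1"
      using max_sum_attained[of "{..<n}" ?f] Suc.prems assms
      by (auto simp: max_pow_Suc_index simp del: max_pow.simps(2))
  next
    assume "\<exists>l<n. ?f l = 1"
    then obtain l where "l < n" "?f l = 1" by blast
    then have "1 \<le> max_pow A (Suc k) $$ (i, j)"
      using le_max_sum[of "{..<n}" l ?f] Suc.prems assms
      by (simp add: max_pow_Suc_index del: max_pow.simps(2))
    then show "max_pow A (Suc k) $$ (i, j) = 1"
      using max_pow_le_one[OF Suc.prems assms(2), of "Suc k"] by linarith
  qed
  also have "\<dots> \<longleftrightarrow> (\<exists>l<n. A $$ (i, l) = 1 \<and> (\<exists>p. U.awalk l p j \<and> length p = k))"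
    using one Suc.IH by blast
  also have "\<dots> \<longleftrightarrow> (\<exists>p. U.awalk i p j \<and> length p = Suc k)"
  proof
    assume "\<exists>l<n. A $$ (i, l) = 1 \<and> (\<exists>p. U.awalk l p j \<and> length p = k)"
    then obtain l p where "l < n" "A $$ (i, l) = 1" "U.awalk l p j" "length p = k" by blast
    then have "U.awalk i ((i, l) # p) j" "length ((i, l) # p) = Suc k"
      using Suc.prems by (auto simp: U.awalk_Cons_iff)
    then show "\<exists>p. U.awalk i p j \<and> length p = Suc k" by blast
  next
    assume "\<exists>p. U.awalk i p j \<and> length p = Suc k"
    then obtain e p where "U.awalk i (e # p) j" "length p = k" by (metis length_Suc_conv)
    then have "snd e < n" "A $$ (i, snd e) = 1" "U.awalk (snd e) p j" by (auto simp: U.awalk_Cons_iff)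
    then show "\<exists>l<n. A $$ (i, l) = 1 \<and> (\<exists>p. U.awalk l p j \<and> length p = k)"
      using \<open>length p = k\<close> by blast
  qed
  finally show ?case .
qed

lemma unit_cycle_critical:
  assumes "U.cycle p"
  shows "critical_cycle A p"
proof -
  have "pre_digraph.cycle (mat_digraph A) p"
    by (rule cycle_mono[OF assms]) (auto simp: mat_digraph_def)
  moreover have p: "set p \<subseteq> arcs U" "p \<noteq> []" using assms unfolding U.cycle_def U.awalk_def by blast+
  from p(1) have "path_weight A p = 1"
    unfolding path_weight_def by (induction p) auto
  then have "geometric_mean A p = 1" using \<open>p \<noteq> []\<close> by (simp add: geometric_mean_def)
  ultimately show ?thesis using max_cycle_mean_one by (simp add: critical_cycle_def)
qed

text \<open>Library cycles are elementary, so the return walk is first shortened to a path; together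
  with \<open>e\<close> it is a cycle of weight 1.\<close>

lemma unit_arc_critical:
  assumes e: "e \<in> arcs U" and p: "U.awalk (snd e) p (fst e)"
  shows "e \<in> critical_edges A"
proof -
  obtain q where q: "U.apath (snd e) q (fst e)"
    using U.apath_awalk_to_apath[OF p] by blast
  have "U.cycle (e # q)"
    unfolding U.cycle_def using e q by (auto simp: U.awalk_Cons_iff U.apath_def intro!: exI[of _ "fst e"])
  then show ?thesis using unit_cycle_critical unfolding critical_edges_def by force
qed

lemma critical_edges_subset_unit: "critical_edges A \<subseteq> arcs U"
proof
  fix e assume e: "e \<in> critical_edges A"
  then obtain p where "pre_digraph.cycle (mat_digraph A) p" "e \<in> set p"
    unfolding critical_edges_def critical_cycle_def by blast
  then have "e \<in> arcs (mat_digraph A)" unfolding pre_digraph.cycle_def pre_digraph.awalk_def by blast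
  moreover have "A $$ e = 1" using e visualized by (simp add: visualized_def)
  ultimately show "e \<in> arcs U" by (auto simp: mat_digraph_def)
qed

section \<open>The critical graph and its components\<close>

abbreviation "K \<equiv> critical_graph A"

lemma K_simps [simp]: "verts K = critical_nodes A" "tail K = fst" "head K = snd"
  "arcs K = critical_edges A"
  by (simp_all add: critical_graph_def)

lemma critical_nodes_subset: "critical_nodes A \<subseteq> {..<n}"
  using critical_edges_subset_unit unfolding critical_nodes_def by auto

sublocale K: fin_digraph "critical_graph A"
proof unfold_locales
  show "finite (arcs K)"
  proof (rule finite_subset)
    show "arcs K \<subseteq> {..<n} \<times> {..<n}" using critical_edges_subset_unit by auto
  qed simp
  show "finite (verts K)" using critical_nodes_subset by (auto intro: finite_subset)
qed (auto simp: critical_nodes_def)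

text \<open>A critical cycle through \<open>e\<close> consists of critical arcs only; running from
  the head of \<open>e\<close> around the rest of it leads back to the tail.\<close>

lemma critical_arc_reverse:
  assumes "e \<in> critical_edges A"
  shows "\<exists>p. K.awalk (snd e) p (fst e)"
proof -
  obtain p where p: "pre_digraph.cycle (mat_digraph A) p" "e \<in> set p" "set p \<subseteq> critical_edges A"
    using assms unfolding critical_edges_def critical_cycle_def by blast
  then obtain w where w: "pre_digraph.awalk (mat_digraph A) w p w" unfolding pre_digraph.cycle_def by blast
  have cas: "pre_digraph.cas (mat_digraph A) = K.cas"
    by (rule cas_eq_if_same_ends) (auto simp: mat_digraph_def)
  have "K.cas w p w" using w unfolding pre_digraph.awalk_def cas by blast
  moreover have "w \<in> verts K"
  proof -
    obtain e' p' where "p = e' # p'" using p(2) by (cases p) auto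
    then show ?thesis using \<open>K.cas w p w\<close> p(3) by (auto simp: critical_nodes_def)
  qed
  ultimately have "K.awalk w p w" using p(3) unfolding K.awalk_def by simp
  moreover obtain q r where "p = q @ e # r" using p(2) by (metis split_list)
  ultimately have "K.awalk (snd e) r w" "K.awalk w q (fst e)"
    by (auto simp: K.awalk_Cons_iff)
  then show ?thesis using K.awalk_appendI by blast
qed

lemma awalk_component_unit:
  assumes "C \<in> crit_components A" "pre_digraph.awalk C u p v"
  shows "U.awalk u p v"
proof (rule awalk_mono[OF assms(2)])
  have "subgraph C K" using assms(1) unfolding crit_components_def
    by (auto dest: K.in_sccs_imp_induced induced_imp_subgraph)
  then show "verts C \<subseteq> verts U" "arcs C \<subseteq> arcs U" "tail C = tail U" "head C = head U"
    using critical_nodes_subset critical_edges_subset_unit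
    by (auto simp: subgraph_def compatible_def)
qed

lemma component_strong:
  assumes "C \<in> crit_components A"
  shows "strong_digraph C"
proof -
  have "wf_digraph C" "strongly_connected C" using assms
    unfolding crit_components_def K.sccs_def by (auto simp: induced_subgraph_def subgraph_def)
  then show ?thesis by (simp add: strong_digraph_def strong_digraph_axioms_def)
qed

lemma component_verts_subset:
  assumes "C \<in> crit_components A"
  shows "verts C \<subseteq> {..<n}"
  using assms critical_nodes_subset unfolding crit_components_def K.sccs_def
  by (auto simp: induced_subgraph_def subgraph_def)

text \<open>Strong components are the classes of mutual reachability.\<close>

lemma component_absorbs:
  assumes "C \<in> crit_components A" "u \<in> verts C" "K.awalk u p v" "K.awalk v q u"
  shows "v \<in> verts C"
proof (rule ccontr)
  assume "v \<notin> verts C"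
  moreover have "verts C \<in> K.sccs_verts"
    using assms(1) unfolding crit_components_def by (intro K.in_sccs_vertsI_sccs) blast
  ultimately show False using assms K.reachable_awalk
    unfolding K.in_sccs_verts_conv_reachable by blast
qed

lemma arc_in_component:
  assumes "C \<in> crit_components A" "e \<in> critical_edges A" "fst e \<in> verts C" "snd e \<in> verts C"
  shows "e \<in> arcs C"
  using assms unfolding crit_components_def K.sccs_def by (auto simp: induced_subgraph_def)

text \<open>The gcd of an empty set of lengths is 0, so a cycle must be exhibited. Some node of the
  component lies on a critical arc; the reverse walk puts both ends of that arc into the component,
  where it closes up.\<close>

lemma cyclicity_component_pos:
  assumes C: "C \<in> crit_components A"
  shows "cyclicity C > 0"
proof -
  interpret C: strong_digraph C using C by (rule component_strong)
  have ends: "tail C = fst" "head C = snd" "verts C \<subseteq> critical_nodes A" "verts C \<noteq> {}"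
    using C unfolding crit_components_def K.sccs_def
    by (auto simp: induced_subgraph_def subgraph_def compatible_def strongly_connected_def)
  then obtain u where u: "u \<in> verts C" "u \<in> critical_nodes A" by blast
  then obtain e where e: "e \<in> critical_edges A" "u = fst e \<or> u = snd e"
    unfolding critical_nodes_def by blast
  have "K.awalk (fst e) [e] (snd e)" using e(1) K.arc_implies_awalk[of e] by simp
  then have "fst e \<in> verts C" "snd e \<in> verts C"
    using u e(2) component_absorbs[OF C] critical_arc_reverse[OF e(1)] by blast+
  moreover from this have "e \<in> arcs C" using arc_in_component C e(1) by blast
  ultimately obtain p where "C.awalk (fst e) (e # p) (fst e)"
    using C.ex_awalk[of "snd e" "fst e"] by (auto simp: C.awalk_Cons_iff ends)
  then have "C.closed_w (e # p)" unfolding C.closed_w_def by auto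
  then obtain c where "C.cycle c" using C.closed_w_imp_cycle by blast
  then have "length c \<in> {length p | p. C.cycle p}" "length c \<noteq> 0"
    unfolding C.cycle_def by auto
  then show ?thesis unfolding cyclicity_def
    by (metis (mono_tags, lifting) Gcd_dvd dvd_0_left_iff gr0I)
qed

lemma cyclicity_dvd_total: "C \<in> crit_components A \<Longrightarrow> cyclicity C dvd total_cyclicity A"
  unfolding total_cyclicity_def by (intro dvd_Lcm) auto

lemma total_cyclicity_pos: "total_cyclicity A > 0"
proof -
  \<comment> \<open>\<open>Lcm\<close> of an infinite set of naturals is 0, hence the need for
    finiteness.\<close>
  have "finite (crit_components A)"
    using K.finite_sccs_verts K.inj_on_verts_sccs
    unfolding crit_components_def K.sccs_verts_conv by (rule finite_imageD)
  then show ?thesis unfolding total_cyclicity_def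
    using cyclicity_component_pos by (metis Lcm_0_iff finite_imageI gr0I imageE less_irrefl)
qed

text \<open>The walk \<open>p\<close> closes up inside the critical component, so all its arcs are critical.\<close>

lemma unit_awalk_in_component:
  assumes C: "C \<in> crit_components A" and u: "u \<in> verts C" and v: "v \<in> verts C"
    and p: "U.awalk u p v"
  shows "pre_digraph.awalk C u p v"
proof -
  interpret C: strong_digraph C using C by (rule component_strong)
  have ends: "tail C = fst" "head C = snd"
    using C unfolding crit_components_def K.sccs_def
    by (auto simp: induced_subgraph_def subgraph_def compatible_def)
  show ?thesis using u p
  proof (induction p arbitrary: u)
    case Nil
    then show ?case by (simp add: U.awalk_Nil_iff C.awalk_Nil_iff)
  next
    case (Cons e p)
    then have e: "e \<in> arcs U" "fst e = u" "U.awalk (snd e) p v" by (auto simp: U.awalk_Cons_iff)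
    obtain q where "C.awalk v q u" using C.ex_awalk v Cons.prems(1) by blast
    then have "U.awalk v q u" by (rule awalk_component_unit[OF C])
    then have crit: "e \<in> critical_edges A"
      using unit_arc_critical e U.awalk_appendI by metis
    \<comment> \<open>The head of the critical arc \<open>e\<close> leads back to \<open>u\<close>,
      so it stays in the component and the induction can continue from it.\<close>
    then have "snd e \<in> verts C"
      using component_absorbs[OF C Cons.prems(1)] critical_arc_reverse[OF crit]
        K.arc_implies_awalk[of e] e(2) by auto
    then show ?case
      using Cons e arc_in_component[OF C crit] by (auto simp: C.awalk_Cons_iff ends)
  qed
qed

end

section \<open>Blocks, strides and circulants\<close>

lemma pick_interval: "i < k \<Longrightarrow> pick {a..<a + k} i = a + i"
proof (induction i)
  case 0
  then show ?case by (auto intro!: Least_equality)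
next
  case (Suc i)
  then have "pick {a..<a + k} i = a + i" by simp
  then show ?case using Suc.prems by (auto intro!: Least_equality)
qed

section \<open>Index ranges of the components in the flattened list of classes\<close>

definition comp_offset :: "nat set list list \<Rightarrow> nat \<Rightarrow> nat" where
  "comp_offset css \<mu> = length (concat (take \<mu> css))"

lemma comp_offset_mono: "\<mu> \<le> \<nu> \<Longrightarrow> comp_offset css \<mu> \<le> comp_offset css \<nu>"
  by (metis comp_offset_def concat_append le_add1 le_add_diff_inverse length_append take_add)

lemma comp_offset_Suc:
  "\<mu> < length css \<Longrightarrow> comp_offset css (Suc \<mu>) = comp_offset css \<mu> + length (css ! \<mu>)"
  by (simp add: comp_offset_def take_Suc_conv_app_nth)

lemma comp_offset_le: "comp_offset css \<mu> \<le> length (concat css)"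
  by (metis append_take_drop_id comp_offset_def concat_append le_add1 length_append)

lemma comp_indices_eq:
  "\<mu> < length css \<Longrightarrow>
    comp_indices css \<mu> = {comp_offset css \<mu>..<comp_offset css \<mu> + length (css ! \<mu>)}"
  using comp_offset_Suc by (simp add: comp_indices_def comp_offset_def)

lemma comp_indices_subset: "comp_indices css \<mu> \<subseteq> {..<length (concat css)}"
  using comp_offset_le[of css "Suc \<mu>"] by (auto simp: comp_indices_def comp_offset_def)

lemma comp_indices_disjoint:
  assumes "\<mu> \<noteq> \<nu>"
  shows "comp_indices css \<mu> \<inter> comp_indices css \<nu> = {}"
proof -
  have "Suc \<mu> \<le> \<nu> \<or> Suc \<nu> \<le> \<mu>" using assms by linarith
  then show ?thesis
    using comp_offset_mono[of "Suc \<mu>" \<nu> css] comp_offset_mono[of "Suc \<nu>" \<mu> css]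
    by (auto simp: comp_indices_def comp_offset_def)
qed

lemma nth_concat_comp_offset:
  assumes "\<mu> < length css" "i < length (css ! \<mu>)"
  shows "concat css ! (comp_offset css \<mu> + i) = css ! \<mu> ! i"
proof -
  have "concat css = concat (take \<mu> css) @ css ! \<mu> @ concat (drop (Suc \<mu>) css)"
    using assms(1) by (metis concat.simps(2) concat_append id_take_nth_drop)
  then show ?thesis using assms(2) by (simp add: comp_offset_def nth_append)
qed

lemma comp_offset_add_less:
  assumes "\<mu> < length css" "i < length (css ! \<mu>)"
  shows "comp_offset css \<mu> + i < length (concat css)"
  using assms comp_offset_le[of css "Suc \<mu>"] by (simp add: comp_offset_Suc)

lemma comp_block_eq:
  assumes "M \<in> carrier_mat (length (concat css)) (length (concat css))"
    "\<mu> < length css" "\<nu> < length css"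
  shows "comp_block css M \<mu> \<nu> = mat (length (css ! \<mu>)) (length (css ! \<nu>))
    (\<lambda>(i, j). M $$ (comp_offset css \<mu> + i, comp_offset css \<nu> + j))"
proof -
  have "{i. i < length (concat css) \<and> i \<in> comp_indices css \<kappa>} = comp_indices css \<kappa>" for \<kappa>
    using comp_indices_subset by blast
  moreover have "card (comp_indices css \<kappa>) = length (css ! \<kappa>)" if "\<kappa> < length css" for \<kappa>
    using that by (simp add: comp_indices_eq)
  ultimately have "comp_block css M \<mu> \<nu> = mat (length (css ! \<mu>)) (length (css ! \<nu>))
    (\<lambda>(i, j). M $$ (pick (comp_indices css \<mu>) i, pick (comp_indices css \<nu>) j))"
    using assms by (simp add: comp_block_def submatrix_def)
  then show ?thesis
    using assms by (auto simp: comp_indices_eq pick_interval intro!: cong_mat)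
qed

text \<open>With \<open>k = c * d\<close>, the sequence \<open>stride c d 0, stride c d 1, \<dots>\<close> lists the residues
  modulo \<open>k\<close> sorted by their residue modulo \<open>d\<close>.\<close>

definition stride :: "nat \<Rightarrow> nat \<Rightarrow> nat \<Rightarrow> nat" where
  "stride c d p = p div c + d * (p mod c)"

lemma stride_less: "p < c * d \<Longrightarrow> stride c d p < c * d"
proof -
  assume p: "p < c * d"
  then have "c > 0" by (cases c) auto
  then have "p div c < d" "p mod c < c" using p by (auto simp: less_mult_imp_div_less mult.commute)
  then have "stride c d p < d + d * (p mod c)" by (simp add: stride_def)
  also have "\<dots> = d * Suc (p mod c)" by simp
  also have "\<dots> \<le> d * c" using \<open>p mod c < c\<close> by (intro mult_le_mono2) simp
  finally show ?thesis by (simp add: mult.commute)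
qed

lemma stride_mod: "p < c * d \<Longrightarrow> stride c d p mod d = p div c"
  by (simp add: stride_def less_mult_imp_div_less mult.commute)

lemma stride_div: "p < c * d \<Longrightarrow> stride c d p div d = p mod c"
  by (cases "d = 0") (simp_all add: stride_def less_mult_imp_div_less mult.commute)

text \<open>Residue and quotient of \<open>stride c d p\<close> by \<open>d\<close> recover quotient
  and remainder of \<open>p\<close> by \<open>c\<close>. So the map is injective, and on a finite
  set also onto.\<close>

lemma bij_betw_stride: "bij_betw (stride c d) {..<c * d} {..<c * d}"
proof -
  have "inj_on (stride c d) {..<c * d}"
  proof (rule inj_onI)
    fix p q assume "p \<in> {..<c * d}" "q \<in> {..<c * d}" "stride c d p = stride c d q"
    then have "p div c = q div c" "p mod c = q mod c"
      by (metis lessThan_iff stride_mod) (metis \<open>p \<in> _\<close> \<open>q \<in> _\<close> \<open>stride c d p = _\<close> lessThan_iff stride_div)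
    then show "p = q" by (metis div_mult_mod_eq)
  qed
  moreover have "stride c d ` {..<c * d} \<subseteq> {..<c * d}" by (auto simp: stride_less)
  ultimately show ?thesis by (simp add: bij_betw_def endo_inj_surj)
qed

text \<open>Being the identity elsewhere, it fixes all other components, and the reorderings of two
  distinct components can be composed without interfering.\<close>

definition comp_stride :: "nat set list list \<Rightarrow> nat \<Rightarrow> nat \<Rightarrow> nat \<Rightarrow> nat" where
  "comp_stride css d \<mu> q = (if q \<in> comp_indices css \<mu>
     then comp_offset css \<mu> + stride (length (css ! \<mu>) div d) d (q - comp_offset css \<mu>) else q)"

lemma comp_stride_permutes:
  assumes "\<mu> < length css" "d dvd length (css ! \<mu>)"
  shows "comp_stride css d \<mu> permutes comp_indices css \<mu>"
proof (rule bij_imp_permutes)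
  let ?o = "comp_offset css \<mu>" and ?c = "length (css ! \<mu>) div d"
  have k: "?c * d = length (css ! \<mu>)" using assms(2) by simp
  have "bij_betw ((+) ?o \<circ> stride ?c d \<circ> (\<lambda>q. q - ?o)) (comp_indices css \<mu>) (comp_indices css \<mu>)"
  proof (intro bij_betw_trans)
    show "bij_betw (\<lambda>q. q - ?o) (comp_indices css \<mu>) {..<?c * d}"
      unfolding comp_indices_eq[OF assms(1)] k
      by (rule bij_betwI[of _ _ _ "(+) ?o"]) auto
    show "bij_betw ((+) ?o) {..<?c * d} (comp_indices css \<mu>)"
      unfolding comp_indices_eq[OF assms(1)] k
      by (rule bij_betwI[of _ _ _ "\<lambda>q. q - ?o"]) auto
  qed (rule bij_betw_stride)
  then show "bij_betw (comp_stride css d \<mu>) (comp_indices css \<mu>) (comp_indices css \<mu>)"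
    by (rule iffD1[OF bij_betw_cong, rotated]) (simp add: comp_stride_def)
qed (simp add: comp_stride_def)

text \<open>A single shift must move \<open>i\<close> to \<open>i'\<close> modulo the number of rows
  and \<open>j\<close> to \<open>j'\<close> modulo the number of columns. The Chinese remainder
  theorem provides it, since the two required displacements agree modulo the gcd.\<close>

lemma rect_circulant_residues:
  assumes B: "rect_circulant B" and "dim_row B > 0"
    and ij: "i < dim_row B" "j < dim_col B" "i' < dim_row B" "j' < dim_col B"
    and cong: "[int j - int i = int j' - int i'] (mod int (gcd (dim_row B) (dim_col B)))"
  shows "B $$ (i, j) = B $$ (i', j')"
proof -
  let ?k = "int (dim_row B)" and ?m = "int (dim_col B)"
  obtain u v where uv: "u * ?k + v * ?m = gcd ?k ?m" using bezout_int by blast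
  obtain w where w: "(int j' - int j) - (int i' - int i) = gcd ?k ?m * w"
    using cong by (metis cong_iff_dvd_diff cong_sym diff_diff_eq diff_add_eq diff_diff_eq2 dvdE
        add.commute gcd_int_int_eq)
  \<comment> \<open>\<open>w\<close> measures the discrepancy of the displacements in units of the
    gcd. Adding \<open>?k * u * w\<close> does not affect the rows and, by Bezout, corrects the
    columns.\<close>
  define t where "t = int i' - int i + ?k * u * w"
  have "t - (int j' - int j) = ?k * u * w - (u * ?k + v * ?m) * w"
    unfolding uv using w by (simp add: t_def)
  also have "\<dots> = ?m * (- v * w)" by (simp add: algebra_simps)
  finally have "[int j' - int j = t] (mod ?m)"
    by (metis cong_iff_dvd_diff cong_sym dvd_triv_left)
  then have "[int j' = int j + t] (mod ?m)"
    by (metis add.commute cong_add_lcancel diff_add_cancel)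
  moreover have "[int i' = int i + t] (mod ?k)"
    by (simp add: t_def cong_iff_dvd_diff)
  ultimately show ?thesis using B ij unfolding rect_circulant_def by blast
qed

text \<open>In stride order, consecutive runs of equal length collect the indices of one residue
  modulo \<open>d\<close>. By \<open>rect_circulant_residues\<close> only the difference of the
  residues matters.\<close>

lemma block_circulant_stride:
  fixes B :: "real mat"
  assumes B: "rect_circulant B" and pos: "dim_row B > 0" "dim_col B > 0"
    and d: "d = gcd (dim_row B) (dim_col B)"
  shows "block_circulant d (mat (dim_row B) (dim_col B)
    (\<lambda>(p, q). B $$ (stride (dim_row B div d) d p, stride (dim_col B div d) d q)))"
proof -
  define c e where "c = dim_row B div d" and "e = dim_col B div d"
  have ce: "c * d = dim_row B" "e * d = dim_col B" unfolding c_def e_def d by simp_all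
  then have pos': "c > 0" "e > 0" "d > 0" using pos by (metis gr0I mult_is_0 less_irrefl)+
  \<comment> \<open>Row 0 serves as reference for the block values. In
    \<open>block_circulant\<close> differences run over 1 to \<open>d\<close>, with \<open>d\<close>
    standing for 0, hence \<open>x mod d\<close>.\<close>
  have "B $$ (stride c d p, stride e d q) = B $$ (0, x mod d)"
    if ij: "i < d" "j < d" "[int j - int i = int x] (mod int d)"
      and p: "i * c \<le> p" "p < Suc i * c" and q: "j * e \<le> q" "q < Suc j * e" for i j x p q
  proof (rule rect_circulant_residues[OF B pos(1)])
    have "Suc i * c \<le> c * d" "Suc j * e \<le> e * d"
      using ij by (metis Suc_leI mult.commute mult_le_mono1)+
    then have less: "p < c * d" "q < e * d" using p q by linarith+
    then show "stride c d p < dim_row B" "stride e d q < dim_col B"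
      using stride_less ce by metis+
    have "d \<le> dim_col B" using pos(2) ce by (metis dvd_imp_le dvd_triv_right)
    then show "x mod d < dim_col B" using pos'(3) by (meson less_le_trans mod_less_divisor)
    have "p div c = i" "q div e = j" using p q by (auto intro!: div_nat_eqI simp: mult.commute)
    then have "stride c d p mod d = i" "stride e d q mod d = j"
      using less by (simp_all add: stride_mod)
    then have "[int (stride c d p) = int i] (mod int d)" "[int (stride e d q) = int j] (mod int d)"
      using ij by (simp_all add: cong_def flip: zmod_int)
    then have "[int (stride e d q) - int (stride c d p) = int j - int i] (mod int d)"
      by (simp add: cong_diff)
    also have "[int j - int i = int (x mod d) - int 0] (mod int d)"
      using ij(3) by (simp add: cong_def zmod_int)
    finally show "[int (stride e d q) - int (stride c d p) = int (x mod d) - int 0]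
      (mod int (gcd (dim_row B) (dim_col B)))" by (simp add: d)
  qed (use pos in auto)
  moreover have "p < dim_row B" if "i < d" "p < Suc i * c" for i p
    using that ce by (metis Suc_leI less_le_trans mult.commute mult_le_mono1)
  moreover have "q < dim_col B" if "j < d" "q < Suc j * e" for j q
    using that ce by (metis Suc_leI less_le_trans mult.commute mult_le_mono1)
  ultimately show ?thesis
    unfolding block_circulant_def c_def[symmetric] e_def[symmetric]
    using pos' ce
    by (intro exI[of _ "\<lambda>x. B $$ (0, x mod d)"] exI[of _ "\<lambda>i. i * c"] exI[of _ "\<lambda>j. j * e"])
      (auto simp: mult.commute)
qed

text \<open>The 1 of column \<open>j\<close> sits in row \<open>\<sigma> j\<close>, so that
  conjugation replaces the indices \<open>p\<close>, \<open>q\<close> by \<open>\<sigma> p\<close>,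
  \<open>\<sigma> q\<close>.\<close>

definition perm_mat :: "nat \<Rightarrow> (nat \<Rightarrow> nat) \<Rightarrow> real mat" where
  "perm_mat N \<sigma> = mat N N (\<lambda>(i, j). if i = \<sigma> j then 1 else 0)"

lemma permutation_matrix_perm_mat:
  assumes "\<sigma> permutes {..<N}"
  shows "permutation_matrix N (perm_mat N \<sigma>)"
proof -
  have ex1: "\<exists>!j. j < N \<and> i = \<sigma> j" if "i < N" for i
  proof (rule ex1I[of _ "inv_into UNIV \<sigma> i"])
    show "inv_into UNIV \<sigma> i < N \<and> i = \<sigma> (inv_into UNIV \<sigma> i)"
      using permutes_in_image[OF permutes_inv[OF assms], of i] that
      by (simp add: permutes_inverses[OF assms])
  qed (auto simp: permutes_inverses[OF assms])
  have less: "\<sigma> j < N" if "j < N" for j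
    using permutes_in_image[OF assms] that by simp
  have "(\<exists>!j. j < N \<and> perm_mat N \<sigma> $$ (i, j) = 1)" if "i < N" for i
  proof -
    have "(j < N \<and> perm_mat N \<sigma> $$ (i, j) = 1) \<longleftrightarrow> (j < N \<and> i = \<sigma> j)" for j
      using that by (auto simp: perm_mat_def split: if_splits)
    then show ?thesis using ex1[OF that] by simp
  qed
  moreover have "(\<exists>!i. i < N \<and> perm_mat N \<sigma> $$ (i, j) = 1)" if "j < N" for j
    using that less[OF that] by (intro ex1I[of _ "\<sigma> j"]) (auto simp: perm_mat_def split: if_splits)
  ultimately show ?thesis
    by (simp add: permutation_matrix_def) (simp add: perm_mat_def)
qed

text \<open>At most one term of each max-sum is nonzero. Nonnegativity matters because
  \<open>max_sum\<close> always includes 0 and would swallow a negative entry.\<close>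

lemma max_mult_perm_mat_conj:
  assumes \<sigma>: "\<sigma> permutes {..<N}" and M: "M \<in> carrier_mat N N"
    and pq: "p < N" "q < N" and nonneg: "0 \<le> M $$ (\<sigma> p, \<sigma> q)"
  shows "max_mult (max_mult (transpose_mat (perm_mat N \<sigma>)) M) (perm_mat N \<sigma>) $$ (p, q) = M $$ (\<sigma> p, \<sigma> q)"
proof -
  let ?P = "perm_mat N \<sigma>"
  have less: "\<sigma> p < N" "\<sigma> q < N" using permutes_in_image[OF \<sigma>] pq by auto
  have P: "dim_row ?P = N" "dim_col ?P = N" by (simp_all add: perm_mat_def)
  have P_index: "?P $$ (i, j) = (if i = \<sigma> j then 1 else 0)" if "i < N" "j < N" for i j
    using that by (simp add: perm_mat_def)
  let ?R = "max_mult (transpose_mat ?P) M"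
  have R: "dim_row ?R = N" "dim_col ?R = N" using M P by (auto simp: max_mult_def)
  have "?R $$ (p, \<sigma> q) = max_sum (\<lambda>k. ?P $$ (k, p) * M $$ (k, \<sigma> q)) {..<N}"
    using M P pq less by (auto simp: max_mult_def max_sum_def image_def)
  also have "\<dots> = ?P $$ (\<sigma> p, p) * M $$ (\<sigma> p, \<sigma> q)"
    using less pq nonneg by (intro max_sum_eq_single) (auto simp: P_index)
  finally have R_index: "?R $$ (p, \<sigma> q) = M $$ (\<sigma> p, \<sigma> q)" using less pq by (simp add: P_index)
  have "max_mult ?R ?P $$ (p, q) = max_sum (\<lambda>l. ?R $$ (p, l) * ?P $$ (l, q)) {..<N}"
    using pq by (simp add: max_mult_def[of ?R] R P)
  also have "\<dots> = ?R $$ (p, \<sigma> q) * ?P $$ (\<sigma> q, q)"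
    using less pq nonneg by (intro max_sum_eq_single) (auto simp: P_index R_index)
  finally show ?thesis using less pq by (simp add: P_index R_index)
qed

section \<open>Reduced powers\<close>

context visualized_matrix
begin

lemma max_pow_period:
  assumes "is_transient A T" "T \<le> r"
  shows "max_pow A (r + total_cyclicity A * c) = max_pow A r"
proof (induction c)
  case (Suc c)
  have "max_pow A (r + total_cyclicity A * c + total_cyclicity A) = max_pow A (r + total_cyclicity A * c)"
    using assms unfolding is_transient_def by (meson trans_le_add1)
  then show ?case using Suc by (simp add: ac_simps)
qed simp

text \<open>The walks \<open>p\<close> and \<open>q\<close> can be prolonged within their components so that their total length
  becomes a multiple of the total cyclicity.\<close>

lemma max_pow_le_shift:
  assumes T: "is_transient A T" "T \<le> r"
    and C: "C \<in> crit_components A" and D: "D \<in> crit_components A"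
    and p: "pre_digraph.awalk C x' p x" "[int (length p) = - t] (mod int (cyclicity C))"
    and q: "pre_digraph.awalk D y q y'" "[int (length q) = t] (mod int (cyclicity D))"
  shows "max_pow A r $$ (x, y) \<le> max_pow A r $$ (x', y')"
proof -
  interpret C: strong_digraph C using C by (rule component_strong)
  interpret D: strong_digraph D using D by (rule component_strong)
  let ?g = "total_cyclicity A"
  have verts: "x < n" "x' < n" "y < n" "y' < n"
    using p(1) q(1) component_verts_subset[OF C] component_verts_subset[OF D] by blast+
  obtain N where N: "\<And>L. L \<ge> N \<Longrightarrow> [L = length p] (mod cyclicity C) \<Longrightarrow>
      \<exists>p. C.awalk x' p x \<and> length p = L"
    using C.ex_awalk_of_large_length[OF p(1)] by blast
  obtain M where M: "\<And>L. L \<ge> M \<Longrightarrow> [L = length q] (mod cyclicity D) \<Longrightarrow>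
      \<exists>p. D.awalk y p y' \<and> length p = L"
    using D.ex_awalk_of_large_length[OF q(1)] by blast
  define s where "s = nat (t mod int ?g)"
  have s: "int s = t mod int ?g" "s < ?g"
    using total_cyclicity_pos unfolding s_def by (simp_all add: nat_less_iff)
  \<comment> \<open>Two lengths congruent to \<open>- t\<close> and \<open>t\<close> modulo
    \<open>?g\<close> whose sum is a multiple of \<open>?g\<close>. The extra period in
    \<open>Suc N\<close> makes up for subtracting \<open>s\<close>, which keeps \<open>a\<close> at
    least \<open>N\<close>.\<close>
  define a b where "a = ?g * Suc N - s" and "b = s + ?g * M"
  have "s \<le> ?g * Suc N" using s(2) by simp
  then have int_a: "int a = int ?g * int (Suc N) - int s" unfolding a_def by (simp only: of_nat_diff of_nat_mult)
  have "t = int ?g * (t div int ?g) + int s" by (simp add: s(1))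
  then have "int a - - t = int ?g * (int (Suc N) + t div int ?g)"
    unfolding int_a distrib_left by linarith
  then have "[int a = - t] (mod int ?g)" by (simp add: cong_iff_dvd_diff)
  moreover have "[int b = t] (mod int ?g)"
    unfolding b_def by (simp add: s(1) cong_def mod_simps)
  ultimately have "[int a = int (length p)] (mod int (cyclicity C))"
    "[int b = int (length q)] (mod int (cyclicity D))"
    using p(2) q(2) cyclicity_dvd_total[OF C] cyclicity_dvd_total[OF D]
    by (meson cong_dvd_modulus cong_sym cong_trans int_dvd_int_iff)+
  moreover have "N \<le> ?g * N" "M \<le> ?g * M" using total_cyclicity_pos by simp_all
  then have "N \<le> a" "M \<le> b" using s(2) unfolding a_def b_def mult_Suc_right by linarith+
  ultimately obtain p' q' where "C.awalk x' p' x" "length p' = a" "D.awalk y q' y'" "length q' = b"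
    using N[of a] M[of b] by (auto simp: cong_int_iff)
  then have one: "max_pow A a $$ (x', x) = 1" "max_pow A b $$ (y, y') = 1"
    using max_pow_eq_one_iff verts awalk_component_unit C D by blast+
  have "max_pow A r $$ (x, y) = max_pow A a $$ (x', x) * max_pow A r $$ (x, y)"
    using one by simp
  also have "\<dots> \<le> max_pow A (a + r) $$ (x', y)" using verts by (intro max_pow_add_ge)
  also have "\<dots> = max_pow A (a + r) $$ (x', y) * max_pow A b $$ (y, y')" using one by simp
  also have "\<dots> \<le> max_pow A (a + r + b) $$ (x', y')" using verts by (intro max_pow_add_ge)
  also have "a + r + b = r + ?g * (Suc N + M)"
    using \<open>s \<le> ?g * Suc N\<close> unfolding a_def b_def by (simp add: algebra_simps)
  finally show ?thesis unfolding max_pow_period[OF T] .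
qed

text \<open>The shift by \<open>t\<close> gives one inequality, the shift back by \<open>- t\<close>
  the other. The positions of the classes determine the residues of the connecting walks.\<close>

lemma max_pow_eq_shift:
  assumes T: "is_transient A T" "T \<le> r"
    and C: "C \<in> crit_components A" "arranged_component C cs"
    and D: "D \<in> crit_components A" "arranged_component D ds"
    and i: "i < cyclicity C" "i' < cyclicity C" "[int i' = int i + t] (mod int (cyclicity C))"
    and j: "j < cyclicity D" "j' < cyclicity D" "[int j' = int j + t] (mod int (cyclicity D))"
    and x: "x \<in> cs ! i" "x' \<in> cs ! i'" and y: "y \<in> ds ! j" "y' \<in> ds ! j'"
  shows "max_pow A r $$ (x, y) = max_pow A r $$ (x', y')"
proof -
  interpret C: arranged_component C cs by fact
  interpret D: arranged_component D ds by fact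
  \<comment> \<open>Reads off the residue of a walk length from the displacement of its end classes.
    The separate \<open>c\<close> permits \<open>- (- t)\<close> in place of
    \<open>t\<close>.\<close>
  have *: "[z = c] (mod m)" if "[a' = a + b] (mod m)" "[a + z = a'] (mod m)" "b = c" for a a' b c z m :: int
    using cong_trans[OF that(2,1)] that(3) by (simp add: cong_add_lcancel)
  have i': "[int i = int i' + - t] (mod int (cyclicity C))"
    and j': "[int j = int j' + - t] (mod int (cyclicity D))"
    using cong_add[OF cong_sym[OF i(3)] cong_refl[of "- t"]] cong_add[OF cong_sym[OF j(3)] cong_refl[of "- t"]]
    by simp_all
  obtain p where p: "C.awalk x' p x" "[int i' + int (length p) = int i] (mod int (cyclicity C))"
    using C.ex_awalk_between[OF i(2,1) x(2,1)] by blast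
  obtain p' where p': "C.awalk x p' x'" "[int i + int (length p') = int i'] (mod int (cyclicity C))"
    using C.ex_awalk_between[OF i(1,2) x] by blast
  obtain q where q: "D.awalk y q y'" "[int j + int (length q) = int j'] (mod int (cyclicity D))"
    using D.ex_awalk_between[OF j(1,2) y] by blast
  obtain q' where q': "D.awalk y' q' y" "[int j' + int (length q') = int j] (mod int (cyclicity D))"
    using D.ex_awalk_between[OF j(2,1) y(2,1)] by blast
  show ?thesis
  proof (rule antisym)
    show "max_pow A r $$ (x, y) \<le> max_pow A r $$ (x', y')"
      using max_pow_le_shift[OF T C(1) D(1) p(1) *[OF i' p(2)] q(1) *[OF j(3) q(2)]] by simp
    show "max_pow A r $$ (x', y') \<le> max_pow A r $$ (x, y)"
      using max_pow_le_shift[OF T C(1) D(1) p'(1) *[OF i(3) p'(2), of "- (- t)"] q'(1) *[OF j' q'(2)]] by simp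
  qed
qed

end

section \<open>Blocks of the reduced power for an arrangement of the classes\<close>

locale arranged_matrix = visualized_matrix +
  fixes Cs :: "(nat, nat \<times> nat) pre_digraph list" and css :: "nat set list list" and T r :: nat
  assumes arrangement: "class_arrangement A Cs css"
    and T: "is_transient A T" "T \<le> r"
begin

lemma length_Cs_le: "length Cs \<le> length css"
  using arrangement by (simp add: class_arrangement_def)

lemma component: "\<mu> < length Cs \<Longrightarrow> Cs ! \<mu> \<in> crit_components A"
  using arrangement nth_mem[of \<mu> Cs] by (simp add: class_arrangement_def)

lemma arranged:
  assumes "\<mu> < length Cs"
  shows "arranged_component (Cs ! \<mu>) (css ! \<mu>)"
proof -
  note C = component[OF assms]
  have "distinct (css ! \<mu>) \<and> set (css ! \<mu>) = cyclic_classes (Cs ! \<mu>) \<and>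
      (\<forall>i<length (css ! \<mu>).
        class_access (Cs ! \<mu>) 1 (css ! \<mu> ! i) (css ! \<mu> ! (Suc i mod length (css ! \<mu>))))"
    using arrangement assms unfolding class_arrangement_def by blast
  then show ?thesis
    using component_strong[OF C] cyclicity_component_pos[OF C]
    unfolding arranged_component_def arranged_component_axioms_def by blast
qed

lemma length_classes: "\<mu> < length Cs \<Longrightarrow> length (css ! \<mu>) = cyclicity (Cs ! \<mu>)"
  using arranged_component.length_cs[OF arranged] .

lemma length_classes_pos: "\<mu> < length Cs \<Longrightarrow> length (css ! \<mu>) > 0"
  by (simp add: length_classes cyclicity_component_pos component)

lemma class_member:
  assumes "\<mu> < length Cs" "i < length (css ! \<mu>)"
  obtains x where "x \<in> css ! \<mu> ! i"
  using arranged_component.class_nonempty[OF arranged[OF assms(1)] assms(2)] by blast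

lemma class_member_less:
  assumes "\<mu> < length Cs" "i < length (css ! \<mu>)" "x \<in> css ! \<mu> ! i"
  shows "x \<in> verts (Cs ! \<mu>)" "x < n"
  using arranged_component.class_subset[OF arranged[OF assms(1)] assms(2)] assms(3)
    component_verts_subset[OF component[OF assms(1)]] by blast+

lemma max_pow_eq_class_shift:
  assumes "\<mu> < length Cs" "\<nu> < length Cs"
    "i < length (css ! \<mu>)" "i' < length (css ! \<mu>)" "[int i' = int i + t] (mod int (length (css ! \<mu>)))"
    "j < length (css ! \<nu>)" "j' < length (css ! \<nu>)" "[int j' = int j + t] (mod int (length (css ! \<nu>)))"
    "x \<in> css ! \<mu> ! i" "x' \<in> css ! \<mu> ! i'" "y \<in> css ! \<nu> ! j" "y' \<in> css ! \<nu> ! j'"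
  shows "max_pow A r $$ (x, y) = max_pow A r $$ (x', y')"
  using max_pow_eq_shift[OF T component[OF assms(1)] arranged[OF assms(1)] component[OF assms(2)]
      arranged[OF assms(2)] assms(3-12)[unfolded length_classes[OF assms(1)] length_classes[OF assms(2)]]] .

definition "R = reduced_power A css r"

lemma R_carrier: "R \<in> carrier_mat (length (concat css)) (length (concat css))"
  by (simp add: R_def reduced_power_def)

text \<open>The shift by 0 shows that the power is constant on a pair of classes, and
  \<open>x\<close>, \<open>y\<close> witness that the classes are nonempty. So the
  \<open>THE\<close> in \<open>reduced_power\<close> is well defined.\<close>

lemma R_index:
  assumes "\<mu> < length Cs" "\<nu> < length Cs" "i < length (css ! \<mu>)" "j < length (css ! \<nu>)"
    "x \<in> css ! \<mu> ! i" "y \<in> css ! \<nu> ! j"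
  shows "R $$ (comp_offset css \<mu> + i, comp_offset css \<nu> + j) = max_pow A r $$ (x, y)"
proof -
  have "(THE a. \<forall>x'\<in>css ! \<mu> ! i. \<forall>y'\<in>css ! \<nu> ! j. max_pow A r $$ (x', y') = a) = max_pow A r $$ (x, y)"
  proof (rule the_equality)
    have "max_pow A r $$ (x', y') = max_pow A r $$ (x, y)" if "x' \<in> css ! \<mu> ! i" "y' \<in> css ! \<nu> ! j" for x' y'
      using that assms(5,6) by (intro max_pow_eq_class_shift[OF assms(1,2,3,3) _ assms(4,4), of 0]) auto
    then show "\<forall>x'\<in>css ! \<mu> ! i. \<forall>y'\<in>css ! \<nu> ! j. max_pow A r $$ (x', y') = max_pow A r $$ (x, y)"
      by blast
  qed (metis assms(5,6))
  then show ?thesis using assms length_Cs_le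
    by (simp add: R_def reduced_power_def comp_offset_add_less nth_concat_comp_offset)
qed

definition "B \<mu> \<nu> = comp_block css R \<mu> \<nu>"

lemma B_eq:
  "\<mu> < length Cs \<Longrightarrow> \<nu> < length Cs \<Longrightarrow> B \<mu> \<nu> = mat (length (css ! \<mu>)) (length (css ! \<nu>))
    (\<lambda>(i, j). R $$ (comp_offset css \<mu> + i, comp_offset css \<nu> + j))"
  unfolding B_def using length_Cs_le by (intro comp_block_eq R_carrier) linarith+

lemma dim_B:
  assumes "\<mu> < length Cs" "\<nu> < length Cs"
  shows "dim_row (B \<mu> \<nu>) = length (css ! \<mu>)" "dim_col (B \<mu> \<nu>) = length (css ! \<nu>)"
  using assms by (simp_all add: B_eq)

lemma B_index:
  assumes "\<mu> < length Cs" "\<nu> < length Cs" "i < length (css ! \<mu>)" "j < length (css ! \<nu>)"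
    "x \<in> css ! \<mu> ! i" "y \<in> css ! \<nu> ! j"
  shows "B \<mu> \<nu> $$ (i, j) = max_pow A r $$ (x, y)"
  using assms R_index by (simp add: B_eq)

lemma rect_circulant_B:
  assumes "\<mu> < length Cs" "\<nu> < length Cs"
  shows "rect_circulant (B \<mu> \<nu>)"
  unfolding rect_circulant_def dim_B[OF assms]
proof (intro allI impI)
  fix i i' j j' and t :: int
  assume i: "i < length (css ! \<mu>)" "i' < length (css ! \<mu>)"
    and j: "j < length (css ! \<nu>)" "j' < length (css ! \<nu>)"
    and t: "[int i' = int i + t] (mod int (length (css ! \<mu>))) \<and>
      [int j' = int j + t] (mod int (length (css ! \<nu>)))"
  obtain x x' y y' where "x \<in> css ! \<mu> ! i" "x' \<in> css ! \<mu> ! i'" "y \<in> css ! \<nu> ! j" "y' \<in> css ! \<nu> ! j'"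
    using class_member assms i j by metis
  then show "B \<mu> \<nu> $$ (i, j) = B \<mu> \<nu> $$ (i', j')"
    using B_index[OF assms] max_pow_eq_class_shift[OF assms i conjunct1[OF t] j conjunct2[OF t]] i j by metis
qed

lemma R_nonneg:
  assumes "\<mu> < length Cs" "\<nu> < length Cs" "p \<in> comp_indices css \<mu>" "q \<in> comp_indices css \<nu>"
  shows "0 \<le> R $$ (p, q)"
proof -
  obtain i j where ij: "p = comp_offset css \<mu> + i" "i < length (css ! \<mu>)"
    "q = comp_offset css \<nu> + j" "j < length (css ! \<nu>)"
    using assms length_Cs_le
    by (auto simp: comp_indices_eq) (metis add_less_cancel_left le_iff_add)
  obtain x y where "x \<in> css ! \<mu> ! i" "y \<in> css ! \<nu> ! j" using class_member assms ij by metis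
  then show ?thesis
    using R_index assms ij max_pow_nonneg class_member_less by metis
qed

text \<open>Rows and columns are sorted by their residue modulo the same \<open>d\<close>: the
  permutation reorders the components \<mu> and \<nu> by strides and fixes everything else.\<close>

lemma block_circulant_conj:
  assumes \<mu>: "\<mu> < length Cs" and \<nu>: "\<nu> < length Cs"
    and d: "d = gcd (length (css ! \<mu>)) (length (css ! \<nu>))"
  shows "\<exists>P. permutation_matrix (length (concat css)) P \<and> respects_components css P \<and>
    block_circulant d (comp_block css (max_mult (max_mult (transpose_mat P) R) P) \<mu> \<nu>)"
proof -
  let ?N = "length (concat css)"
  have less: "\<mu> < length css" "\<nu> < length css" using \<mu> \<nu> length_Cs_le by auto
  define \<sigma> where "\<sigma> = comp_stride css d \<mu> \<circ> comp_stride css d \<nu>"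
  have perm: "comp_stride css d \<kappa> permutes comp_indices css \<kappa>" if "\<kappa> = \<mu> \<or> \<kappa> = \<nu>" for \<kappa>
    using that less by (auto simp: d intro!: comp_stride_permutes)
  have in_comp: "comp_stride css d \<kappa> q \<in> comp_indices css \<iota> \<longleftrightarrow> q \<in> comp_indices css \<iota>"
    if "\<kappa> = \<mu> \<or> \<kappa> = \<nu>" for \<kappa> \<iota> q
  proof (cases "q \<in> comp_indices css \<kappa>")
    case True
    then have "comp_stride css d \<kappa> q \<in> comp_indices css \<kappa>"
      using permutes_in_image[OF perm[OF that]] by blast
    then show ?thesis using True comp_indices_disjoint[of \<kappa> \<iota> css] by blast
  next
    case False
    then show ?thesis by (simp add: comp_stride_def)
  qed
  have \<sigma>_in: "\<sigma> q \<in> comp_indices css \<iota> \<longleftrightarrow> q \<in> comp_indices css \<iota>" for \<iota> q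
    by (simp add: \<sigma>_def in_comp)
  have permN: "\<sigma> permutes {..<?N}"
    unfolding \<sigma>_def using perm comp_indices_subset by (intro permutes_compose) (blast intro: permutes_subset)+
  define P where "P = perm_mat ?N \<sigma>"
  have P: "permutation_matrix ?N P" unfolding P_def using permN by (rule permutation_matrix_perm_mat)
  have P_comp: "respects_components css P"
    unfolding respects_components_def P_def perm_mat_def by (auto simp: \<sigma>_in split: if_splits)
  let ?s = "\<lambda>\<kappa>. stride (length (css ! \<kappa>) div d) d"
  have \<sigma>_offset: "\<sigma> (comp_offset css \<kappa> + i) = comp_offset css \<kappa> + ?s \<kappa> i"
    if \<kappa>: "\<kappa> = \<mu> \<or> \<kappa> = \<nu>" and i: "i < length (css ! \<kappa>)" for \<kappa> i
  proof -
    have dk: "length (css ! \<kappa>) div d * d = length (css ! \<kappa>)" using \<kappa> by (auto simp: d)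
    have s_less: "?s \<kappa> i < length (css ! \<kappa>)"
      using stride_less[of i "length (css ! \<kappa>) div d" d] i dk by simp
    have in_\<kappa>: "comp_offset css \<kappa> + k \<in> comp_indices css \<kappa>" if "k < length (css ! \<kappa>)" for k
      using that \<kappa> less by (auto simp: comp_indices_eq)
    have moved: "comp_stride css d \<kappa> (comp_offset css \<kappa> + k) = comp_offset css \<kappa> + ?s \<kappa> k"
      if "k < length (css ! \<kappa>)" for k
      using in_\<kappa>[OF that] by (simp add: comp_stride_def)
    have fixed: "comp_stride css d \<iota> (comp_offset css \<kappa> + k) = comp_offset css \<kappa> + k"
      if "k < length (css ! \<kappa>)" "\<iota> \<noteq> \<kappa>" for \<iota> k
      using in_\<kappa>[OF that(1)] comp_indices_disjoint[OF that(2), of css] by (auto simp: comp_stride_def)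
    show ?thesis
    proof (cases "\<mu> = \<nu>")
      case True
      \<comment> \<open>For \<mu> = \<nu> the reordering is applied twice to the same component.
        This does no harm: \<open>d\<close> is then the full number of classes, and the stride is
        the identity.\<close>
      then have "?s \<kappa> k = k" for k
        using \<kappa> length_classes_pos[OF \<mu>] by (auto simp: d stride_def)
      then show ?thesis using True \<kappa> moved i by (auto simp: \<sigma>_def)
    next
      case False
      then show ?thesis using \<kappa> moved[OF i] moved[OF s_less] fixed[OF i] fixed[OF s_less]
        by (auto simp: \<sigma>_def)
    qed
  qed
  have s_less: "?s \<kappa> i < length (css ! \<kappa>)" if "\<kappa> = \<mu> \<or> \<kappa> = \<nu>" "i < length (css ! \<kappa>)" for \<kappa> i
    using stride_less[of i "length (css ! \<kappa>) div d" d] that by (auto simp: d)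
  let ?M = "max_mult (max_mult (transpose_mat P) R) P"
  have "?M \<in> carrier_mat ?N ?N" unfolding P_def perm_mat_def max_mult_def by simp
  then have "comp_block css ?M \<mu> \<nu> = mat (length (css ! \<mu>)) (length (css ! \<nu>))
    (\<lambda>(i, j). ?M $$ (comp_offset css \<mu> + i, comp_offset css \<nu> + j))"
    using less by (rule comp_block_eq)
  also have "\<dots> = mat (dim_row (B \<mu> \<nu>)) (dim_col (B \<mu> \<nu>)) (\<lambda>(i, j). B \<mu> \<nu> $$ (?s \<mu> i, ?s \<nu> j))"
  proof (rule cong_mat)
    fix i j assume ij: "i < length (css ! \<mu>)" "j < length (css ! \<nu>)"
    let ?p = "comp_offset css \<mu> + i" and ?q = "comp_offset css \<nu> + j"
    have "?p \<in> comp_indices css \<mu>" "?q \<in> comp_indices css \<nu>" "?p < ?N" "?q < ?N"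
      using ij less by (auto simp: comp_indices_eq comp_offset_add_less)
    \<comment> \<open>Since \<open>\<sigma>\<close> preserves components, \<open>R_nonneg\<close>
      covers the addressed entry, as the conjugation lemma demands.\<close>
    then have "?M $$ (?p, ?q) = R $$ (\<sigma> ?p, \<sigma> ?q)"
      unfolding P_def using R_nonneg[OF \<mu> \<nu>] \<sigma>_in
      by (intro max_mult_perm_mat_conj permN R_carrier) blast+
    also have "\<dots> = B \<mu> \<nu> $$ (?s \<mu> i, ?s \<nu> j)"
      using ij \<sigma>_offset s_less by (simp add: B_eq[OF \<mu> \<nu>])
    finally show "(case (i, j) of (i, j) \<Rightarrow> ?M $$ (comp_offset css \<mu> + i, comp_offset css \<nu> + j)) =
      (case (i, j) of (i, j) \<Rightarrow> B \<mu> \<nu> $$ (?s \<mu> i, ?s \<nu> j))" by simp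
  qed (simp_all add: dim_B \<mu> \<nu>)
  finally have "block_circulant d (comp_block css ?M \<mu> \<nu>)"
    using block_circulant_stride[OF rect_circulant_B[OF \<mu> \<nu>], of d] length_classes_pos \<mu> \<nu> d
    by (simp add: dim_B)
  then show ?thesis using P P_comp by blast
qed

text \<open>Periodicity gives \<open>A^(2r) = A^r\<close>, hence the product of the block with
  itself is at most the block; the unit diagonal gives the reverse inequality. An off-diagonal 1
  would be a unit walk of residue 0 between different classes.\<close>

lemma diagonal_block_kleene_star:
  assumes \<mu>: "\<mu> < length Cs" and dvd: "total_cyclicity A dvd r"
  shows "kleene_star (B \<mu> \<mu>)"
    and "\<And>i j. i < length (css ! \<mu>) \<Longrightarrow> j < length (css ! \<mu>) \<Longrightarrow> i \<noteq> j \<Longrightarrow> B \<mu> \<mu> $$ (i, j) < 1"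
proof -
  note C = component[OF \<mu>]
  interpret C: arranged_component "Cs ! \<mu>" "css ! \<mu>" using \<mu> by (rule arranged)
  let ?k = "length (css ! \<mu>)" and ?g = "total_cyclicity A"
  have r: "[r + ?g * c = 0] (mod cyclicity (Cs ! \<mu>))" for c
    using dvd cyclicity_dvd_total[OF C] by (meson cong_0_iff dvd_add dvd_mult2 dvd_trans)
  have diag: "B \<mu> \<mu> $$ (i, i) = 1" if i: "i < ?k" for i
  proof -
    obtain x where x: "x \<in> css ! \<mu> ! i" using class_member \<mu> i by blast
    note x' = class_member_less[OF \<mu> i x]
    have "C.awalk x [] x" using x' by (simp add: C.awalk_Nil_iff)
    then obtain N where N: "\<And>L. L \<ge> N \<Longrightarrow> [L = 0] (mod cyclicity (Cs ! \<mu>)) \<Longrightarrow>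
        \<exists>p. C.awalk x p x \<and> length p = L"
      using C.ex_awalk_of_large_length by (metis list.size(3))
    \<comment> \<open>The length \<open>r\<close> may be too short for a closed walk at
      \<open>x\<close>. Adding \<open>N\<close> periods makes it long enough without changing the
      power.\<close>
    have "N \<le> r + ?g * N" using total_cyclicity_pos by (simp add: trans_le_add2)
    then obtain p where "C.awalk x p x" "length p = r + ?g * N" using N r by blast
    then have "max_pow A (r + ?g * N) $$ (x, x) = 1"
      using max_pow_eq_one_iff x' awalk_component_unit[OF C] by blast
    then show ?thesis using B_index \<mu> i x max_pow_period[OF T] by simp
  qed
  show "B \<mu> \<mu> $$ (i, j) < 1" if ij: "i < ?k" "j < ?k" "i \<noteq> j" for i j
  proof -
    obtain x y where xy: "x \<in> css ! \<mu> ! i" "y \<in> css ! \<mu> ! j" using class_member \<mu> ij by metis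
    note x' = class_member_less[OF \<mu> ij(1) xy(1)] and y' = class_member_less[OF \<mu> ij(2) xy(2)]
    have "max_pow A r $$ (x, y) \<noteq> 1"
    proof
      assume "max_pow A r $$ (x, y) = 1"
      then obtain p where "U.awalk x p y" "length p = r" using max_pow_eq_one_iff x' y' by blast
      then have "C.awalk x p y" "[length p = 0] (mod cyclicity (Cs ! \<mu>))"
        using unit_awalk_in_component[OF C] x' y' r[of 0] by auto
      then show False using C.same_class_iff[OF ij(1,2) xy] ij(3) by blast
    qed
    then show ?thesis using max_pow_le_one[OF x'(2) y'(2), of r] B_index[OF \<mu> \<mu> ij(1,2) xy] by simp
  qed
  have B_mult: "B \<mu> \<mu> $$ (i, l) * B \<mu> \<mu> $$ (l, j) \<le> B \<mu> \<mu> $$ (i, j)" "0 \<le> B \<mu> \<mu> $$ (i, j)"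
    if ijl: "i < ?k" "j < ?k" "l < ?k" for i j l
  proof -
    obtain x y z where xyz: "x \<in> css ! \<mu> ! i" "y \<in> css ! \<mu> ! j" "z \<in> css ! \<mu> ! l"
      using class_member \<mu> ijl by metis
    have less: "x < n" "y < n" "z < n" using class_member_less \<mu> ijl xyz by blast+
    obtain c where "r = ?g * c" using dvd by blast
    then have "max_pow A (r + r) = max_pow A r" using max_pow_period[OF T] by metis
    then show "B \<mu> \<mu> $$ (i, l) * B \<mu> \<mu> $$ (l, j) \<le> B \<mu> \<mu> $$ (i, j)" "0 \<le> B \<mu> \<mu> $$ (i, j)"
      using max_pow_add_ge[OF less(1,3,2), of r r] max_pow_nonneg[OF less(1,2)]
      by (simp_all add: B_index[OF \<mu> \<mu> ijl(1,2) xyz(1,2)] B_index[OF \<mu> \<mu> ijl(1,3) xyz(1,3)]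
          B_index[OF \<mu> \<mu> ijl(3,2) xyz(3,2)])
  qed
  have "max_mult (B \<mu> \<mu>) (B \<mu> \<mu>) = B \<mu> \<mu>"
  proof (rule eq_matI)
    fix i j assume "i < dim_row (B \<mu> \<mu>)" "j < dim_col (B \<mu> \<mu>)"
    then have ij: "i < ?k" "j < ?k" using \<mu> by (auto simp: dim_B)
    let ?f = "\<lambda>l. B \<mu> \<mu> $$ (i, l) * B \<mu> \<mu> $$ (l, j)"
    have "max_sum ?f {..<?k} = B \<mu> \<mu> $$ (i, j)"
    proof (rule antisym)
      show "max_sum ?f {..<?k} \<le> B \<mu> \<mu> $$ (i, j)" using B_mult ij by (intro max_sum_le) auto
      \<comment> \<open>The term \<open>l = i\<close> has first factor 1.\<close>
      show "B \<mu> \<mu> $$ (i, j) \<le> max_sum ?f {..<?k}"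
        using le_max_sum[of "{..<?k}" i ?f] ij diag by simp
    qed
    then show "max_mult (B \<mu> \<mu>) (B \<mu> \<mu>) $$ (i, j) = B \<mu> \<mu> $$ (i, j)"
      using ij \<mu> by (simp add: max_mult_def dim_B)
  qed (simp_all add: max_mult_def)
  then show "kleene_star (B \<mu> \<mu>)" using diag \<mu> by (simp add: kleene_star_def dim_B)
qed

end

theorem proposition5p4:
  fixes A :: "real mat" and n r T \<mu> \<nu> d :: nat
    and Cs :: "(nat, nat \<times> nat) pre_digraph list"
    and css :: "nat set list list"
  assumes "A \<in> carrier_mat n n"
    and "\<forall>i<n. \<forall>j<n. A $$ (i, j) \<ge> 0"
    and "irreducible_mat A" and "definite_mat A" and "visualized A"
    and "is_transient A T" and "r \<ge> T"
    and "class_arrangement A Cs css"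
    and "\<mu> < length Cs" and "\<nu> < length Cs"
    and "d = gcd (cyclicity (Cs ! \<mu>)) (cyclicity (Cs ! \<nu>))"
  shows "(rect_circulant (comp_block css (reduced_power A css r) \<mu> \<nu>) \<and>
          (\<mu> = \<nu> \<longrightarrow> circulant (comp_block css (reduced_power A css r) \<mu> \<nu>))) \<and>
         (\<exists>P. permutation_matrix (length (concat css)) P \<and> respects_components css P \<and>
           block_circulant d
             (comp_block css
               (max_mult (max_mult (transpose_mat P) (reduced_power A css r)) P) \<mu> \<nu>)) \<and>
         (total_cyclicity A dvd r \<longrightarrow>
           (let B = comp_block css (reduced_power A css r) \<mu> \<mu> in
             circulant B \<and> kleene_star B \<and>
             (\<forall>i<dim_row B. \<forall>j<dim_col B. i \<noteq> j \<longrightarrow> B $$ (i, j) < 1)))"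
proof -
  interpret arranged_matrix A n Cs css T r
    using assms(1,2,5-8) by unfold_locales blast+
  \<comment> \<open>Serves both the case \<mu> = \<nu> of the first claim and the third
    claim.\<close>
  have circ: "circulant (B \<mu> \<mu>)"
    using assms(9) by (simp add: circulant_def rect_circulant_B dim_B)
  have "d = gcd (length (css ! \<mu>)) (length (css ! \<nu>))"
    using assms(9-11) by (simp add: length_classes)
  then show ?thesis
    using circ rect_circulant_B[OF assms(9,10)] block_circulant_conj[OF assms(9,10)]
      diagonal_block_kleene_star[OF assms(9)] assms(9)
    unfolding R_def[symmetric] B_def[symmetric] by (auto simp: Let_def dim_B)
qed

end
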